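(* For every $d\in\mathbb{N}$ there exist constants $c=c(d)\in\mathbb{N}$ and $C=C(d)>0$ such that the following holds. Let $A\subseteq\mathbb{R}^d$ be a finite, non-empty set with $\dim(A)=d$ such that for any $a_1,\dots,a_c\in A$ we have \[ |A+\{a_1,\dots,a_c\}|\leq (d+1+1/16)|A|. \] Then either $|A|\leq C$, or $A\subseteq T+l=\bigcup_{t\in T}(t+l)$, where $l$ is a one-dimensional subspace of $\mathbb{R}^d$ and $T\subseteq\mathbb{R}^d$ satisfies $|T|\leq (d+1)^2$.
   Context: For a finite non-empty $A\subseteq\mathbb{R}^d$, $\dim(A)$ denotes the dimension of the affine span of $A$. For $X,Y\subseteq\mathbb{R}^d$, $X+Y=\{x+y:x\in X,y\in Y\}$. *)

theory Defs
  imports "HOL-Analysis.Analysis" "HOL-Library.Set_Algebras"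
begin

end

theory Submission
  imports Defs
begin

text \<open>Suppose that all sumsets of \<open>A\<close> with few of its elements are small. Since random tuples of elements of
  \<open>A\<close> soon span almost the same sumset with \<open>A\<close>, two of them are translates of each other by some \<open>x\<close>; this
  sumset is then almost invariant under \<open>x\<close>, so that \<open>A\<close> is covered by few lines parallel to \<open>x\<close>,
  compared with its size. Slicing along \<open>x\<close> and inducting on \<open>h\<close> shows that a set with few points on each
  affine subspace of dimension less than \<open>h\<close> expands by a factor of almost \<open>2 ^ h\<close>.

  Now let \<open>h\<close> be the least dimension of a subspace such that boundedly many of its translates cover \<open>A\<close>, with
  bounds decreasing rapidly in \<open>h\<close>. The set \<open>T\<close> of these translates has affine dimension \<open>d - h\<close>, and
  a weighted form of Freiman's lemma on \<open>T\<close>, together with the expansion of the individual pieces of \<open>A\<close>, gives a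
  factor of almost \<open>2 ^ h + d - h\<close>, which is at least \<open>d + 2\<close> if \<open>h \<ge> 2\<close>. If \<open>h = 1\<close>, the factor
  \<open>d + 1\<close> obtained in this way improves by \<open>1/8\<close> as soon as \<open>T\<close> has more than \<open>(d + 1)\<^sup>2\<close> elements.\<close>

section \<open>Boundedly many translates\<close>

text \<open>Only sums of \<open>A\<close> with boundedly many of its own elements are controlled, so
  every lower bound for a sumset has to be realised by boundedly many summands. For two finite sets,
  \<open>card X + card Y - 1\<close> is reached with three: a farthest pair, whose difference serves
  as a modulus, and one further element found by averaging. The missing 1 is harmless, since it
  occurs once per pair of lines or fibres, and these are few compared with \<open>card A\<close>. In
  the expansion by \<open>2 ^ h\<close> each projection doubles the factor: two fibres of about
  equal size add up to twice that size, while the projected set expands by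
  \<open>2 ^ (h - 1)\<close>. Slicing the projection by fibre size is what makes fibres comparable.
  In the final count the dimension of the subspace is minimal, so a translate of a smaller subspace
  cannot carry much of \<open>A\<close>: otherwise disjoint shifts of that part would exceed the
  bound for \<open>A\<close>. This makes every large piece of \<open>A\<close> nondegenerate. The
  \<open>1/16\<close> of the hypothesis lies below the gain \<open>1/8\<close> for many lines, and
  the difference absorbs the bounded errors once \<open>card A\<close> exceeds
  \<open>C\<close>.\<close>

lemma card_fibre_sums:
  fixes q :: "'a::ab_group_add \<Rightarrow> 'b"
  assumes "finite A" "finite C" "finite S"
    and "\<And>s. s \<in> S \<Longrightarrow> P s \<subseteq> A" and "\<And>s. s \<in> S \<Longrightarrow> D s \<subseteq> C"
    and q: "\<And>s a c. s \<in> S \<Longrightarrow> a \<in> P s \<Longrightarrow> c \<in> D s \<Longrightarrow> q (a + c) = s"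
  shows "(\<Sum>s\<in>S. card (P s + D s)) \<le> card (A + C)"
proof -
  have fin: "finite (P s + D s)" if "s \<in> S" for s
    using assms that by (meson finite_set_plus finite_subset)
  have "(\<Sum>s\<in>S. card (P s + D s)) = card (\<Union>s\<in>S. P s + D s)"
  proof (rule card_UN_disjoint[symmetric])
    show "\<forall>i\<in>S. \<forall>j\<in>S. i \<noteq> j \<longrightarrow> (P i + D i) \<inter> (P j + D j) = {}"
      by (auto simp: set_plus_def) (metis q)
  qed (use assms fin in auto)
  also have "\<dots> \<le> card (A + C)"
    using assms by (intro card_mono finite_set_plus UN_least set_plus_mono2) auto
  finally show ?thesis .
qed

lemma finite_has_maximizer:
  fixes f :: "'a \<Rightarrow> real"
  assumes "finite A" "A \<noteq> {}"
  shows "\<exists>x\<in>A. \<forall>y\<in>A. f y \<le> f x"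
  using Max_in[of "f ` A"] Max_ge[of "f ` A"] assms by fastforce

lemma sum_card_swap:
  assumes "finite A" "finite B"
  shows "(\<Sum>a\<in>A. card {b \<in> B. P a b}) = (\<Sum>b\<in>B. card {a \<in> A. P a b})"
  using sum.swap_restrict[OF assms, of "\<lambda>_ _. 1::nat" P] by simp

lemma card_translate: "card (A + {b}) = card A" for b :: "'a::ab_group_add"
proof -
  have "A + {b} = (\<lambda>a. a + b) ` A" by (auto simp: set_plus_def)
  then show ?thesis by (simp add: card_image)
qed

text \<open>Counting modulo \<open>hi - lo\<close>: the translates by \<open>lo\<close> and \<open>hi\<close> gain one element per residue class
  met by \<open>Y\<close>, and the translate by \<open>b\<close> gains whatever lies in a new residue class.\<close>

lemma sum_three_translates:
  fixes Y B :: "'a::real_inner set"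
  assumes "finite Y" "finite B" and lo: "lo \<in> B" and hi: "hi \<in> B" and m: "m = hi - lo" "m \<noteq> 0"
    and dist: "\<And>b b' k. b \<in> B - {hi} \<Longrightarrow> b' \<in> B - {hi} \<Longrightarrow> b - b' = of_int k *\<^sub>R m \<Longrightarrow> b = b'"
  shows "(card B - 1) * (card Y + min (card Y) (card B - 1))
           \<le> (\<Sum>b\<in>B - {hi}. card (Y + {lo, hi, b}))"
proof -
  \<comment> \<open>\<open>Z\<close> has the topmost point of each class of \<open>Y\<close> modulo
    \<open>m\<close>, so \<open>card Z\<close> is the number of classes; \<open>G b\<close> has the
    points that the shift by \<open>b - lo\<close> moves into a class missed by
    \<open>Y\<close>.\<close>
  define Z where "Z = {y \<in> Y. \<forall>k::int. k \<ge> 1 \<longrightarrow> y + of_int k *\<^sub>R m \<notin> Y}"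
  define G where "G b = {y \<in> Y. \<forall>k::int. y + (b - lo) + of_int k *\<^sub>R m \<notin> Y}" for b
  have finZ: "finite Z" and finG: "finite (G b)" for b
    using \<open>finite Y\<close> by (auto simp: Z_def G_def)
  have top: "\<exists>z\<in>Z. \<exists>k::int. z = y + of_int k *\<^sub>R m" if "y \<in> Y" for y
  proof -
    define F where "F = {y' \<in> Y. \<exists>k::int. y' = y + of_int k *\<^sub>R m}"
    have "finite F" "F \<noteq> {}"
      using \<open>finite Y\<close> that by (auto simp: F_def intro!: exI[of _ "0::int"])
    then obtain z where z: "z \<in> F" "\<And>y'. y' \<in> F \<Longrightarrow> y' \<bullet> m \<le> z \<bullet> m"
      using finite_has_maximizer[of F "\<lambda>y'. y' \<bullet> m"] by blast
    obtain k0 :: int where k0: "z = y + of_int k0 *\<^sub>R m" using z by (auto simp: F_def)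
    have "z + of_int k *\<^sub>R m \<notin> Y" if "k \<ge> 1" for k :: int
    proof
      assume "z + of_int k *\<^sub>R m \<in> Y"
      then have "z + of_int k *\<^sub>R m \<in> F"
        unfolding F_def k0 by (auto intro!: exI[of _ "k0 + k"] simp: algebra_simps)
      from z(2)[OF this] have "of_int k * (m \<bullet> m) \<le> 0" by (simp add: inner_add_left)
      moreover have "m \<bullet> m > 0" using m by simp
      ultimately show False using that by (simp add: mult_le_0_iff)
    qed
    then show ?thesis using z k0 by (auto simp: Z_def F_def)
  qed
  have c1: "card Y + card Z + card (G b) \<le> card (Y + {lo, hi, b})" for b
  proof -
    have a: "(Y + {lo}) \<inter> (Z + {hi}) = {}"
    proof -
      have "False" if "y \<in> Y" "z \<in> Z" "y + lo = z + hi" for y z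
      proof -
        have "z + of_int 1 *\<^sub>R m = y" using that(3) by (simp add: m(1)) (metis add.commute add_diff_cancel_right' add_diff_eq)
        with that show False unfolding Z_def by force
      qed
      then show ?thesis by (auto simp: set_plus_def)
    qed
    have b: "((Y + {lo}) \<union> (Z + {hi})) \<inter> (G b + {b}) = {}"
    proof -
      have "False" if "y \<in> Y" "g \<in> G b" "y + lo = g + b" for y g
      proof -
        have "g + (b - lo) + of_int 0 *\<^sub>R m = y" using that by (simp add: algebra_simps)
        with that show False unfolding G_def by blast
      qed
      moreover have "False" if "y \<in> Z" "g \<in> G b" "y + hi = g + b" for y g
      proof -
        have "g + (b - lo) + of_int (-1) *\<^sub>R m = y"
          using arg_cong[OF that(3), of "\<lambda>x. x - hi"] by (simp add: m(1) algebra_simps)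
        with that show False unfolding G_def Z_def by blast
      qed
      ultimately show ?thesis by (auto simp: set_plus_def) metis+
    qed
    have "card Y + card Z + card (G b) = card ((Y + {lo}) \<union> (Z + {hi}) \<union> (G b + {b}))"
      using a b \<open>finite Y\<close> finZ finG
      by (simp add: card_Un_disjoint finite_set_plus card_translate)
    also have "\<dots> \<le> card (Y + {lo, hi, b})"
      using \<open>finite Y\<close> by (intro card_mono finite_set_plus) (auto simp: set_plus_def Z_def G_def)
    finally show ?thesis .
  qed
  \<comment> \<open>For fixed \<open>y\<close>, every \<open>b\<close> with
    \<open>y \<notin> G b\<close> moves \<open>y\<close> into a class met by \<open>Y\<close>. By
    \<open>dist\<close> different \<open>b\<close> reach different classes, and there are only
    \<open>card Z\<close> of them.\<close>
  have c2: "card B - 1 - card Z \<le> card {b \<in> B - {hi}. y \<in> G b}" if y: "y \<in> Y" for y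
  proof -
    have "\<exists>z\<in>Z. \<exists>k::int. z = y + (b - lo) + of_int k *\<^sub>R m" if b: "b \<in> B - {hi}" "y \<notin> G b" for b
    proof -
      obtain k :: int where "y + (b - lo) + of_int k *\<^sub>R m \<in> Y" using b y by (auto simp: G_def)
      from top[OF this] obtain z and k' :: int where "z \<in> Z" "z = y + (b - lo) + of_int k *\<^sub>R m + of_int k' *\<^sub>R m"
        by blast
      moreover from this have "z = y + (b - lo) + of_int (k + k') *\<^sub>R m" by (simp add: algebra_simps)
      ultimately show ?thesis by blast
    qed
    then obtain f where f: "\<And>b. b \<in> B - {hi} \<Longrightarrow> y \<notin> G b \<Longrightarrow> f b \<in> Z"
       "\<And>b. b \<in> B - {hi} \<Longrightarrow> y \<notin> G b \<Longrightarrow> \<exists>k::int. f b = y + (b - lo) + of_int k *\<^sub>R m"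
      by metis
    have "inj_on f {b \<in> B - {hi}. y \<notin> G b}"
    proof (rule inj_onI)
      fix b b' assume *: "b \<in> {b \<in> B - {hi}. y \<notin> G b}" "b' \<in> {b \<in> B - {hi}. y \<notin> G b}" "f b = f b'"
      then obtain k k' :: int where "f b = y + (b - lo) + of_int k *\<^sub>R m" "f b' = y + (b' - lo) + of_int k' *\<^sub>R m"
        using f(2) by blast
      then have "b - b' = of_int (k' - k) *\<^sub>R m" using *(3) by (simp add: algebra_simps)
      then show "b = b'" using dist * by blast
    qed
    then have "card {b \<in> B - {hi}. y \<notin> G b} \<le> card Z"
      using f(1) finZ by (intro card_inj_on_le) auto
    moreover have "card (B - {hi}) = card {b \<in> B - {hi}. y \<notin> G b} + card {b \<in> B - {hi}. y \<in> G b}"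
      using \<open>finite B\<close> by (subst card_Un_disjoint[symmetric]) (auto intro!: arg_cong[where f=card])
    ultimately show ?thesis using hi \<open>finite B\<close> by simp
  qed
  define n where "n = card B - 1"
  have n: "card (B - {hi}) = n" using hi \<open>finite B\<close> by (simp add: n_def)
  have "card Y * (n - card Z) \<le> (\<Sum>y\<in>Y. card {b \<in> B - {hi}. y \<in> G b})"
    using sum_bounded_below[of Y "n - card Z"] c2 by (simp add: n_def)
  also have "\<dots> = (\<Sum>b\<in>B - {hi}. card {y \<in> Y. y \<in> G b})"
    using \<open>finite Y\<close> \<open>finite B\<close> by (intro sum_card_swap) auto
  also have "\<dots> = (\<Sum>b\<in>B - {hi}. card (G b))"
    by (intro sum.cong arg_cong[where f=card]) (auto simp: G_def)
  finally have "n * (card Y + card Z) + card Y * (n - card Z)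
     \<le> (\<Sum>b\<in>B - {hi}. card Y + card Z + card (G b))"
    by (simp add: sum.distrib n algebra_simps)
  also have "\<dots> \<le> (\<Sum>b\<in>B - {hi}. card (Y + {lo, hi, b}))"
    by (intro sum_mono c1)
  finally have *: "n * (card Y + card Z) + card Y * (n - card Z)
     \<le> (\<Sum>b\<in>B - {hi}. card (Y + {lo, hi, b}))" .
  \<comment> \<open>For \<open>card Z \<le> n\<close> the right side exceeds
    \<open>n * card Y\<close> by \<open>n\<close> times a convex combination of \<open>n\<close> and
    \<open>card Y\<close>, with weights \<open>card Z / n\<close> and
    \<open>1 - card Z / n\<close>.\<close>
  have "n * (card Y + min (card Y) n) \<le> n * (card Y + card Z) + card Y * (n - card Z)"
  proof (cases "n \<le> card Z")
    case True
    then show ?thesis by (simp add: min_le_iff_disj)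
  next
    case False
    define r where "r = n - card Z"
    have nr: "n = card Z + r" using False by (simp add: r_def)
    have "n * min (card Y) n \<le> n * card Z + card Y * r"
    proof (cases "card Y \<le> n")
      case True
      have "card Y * card Z \<le> n * card Z" using True by simp
      then show ?thesis using True by (simp add: min_def nr algebra_simps)
    next
      case False
      have "n * r \<le> card Y * r" using False by simp
      then have "n * card Z + n * r \<le> n * card Z + card Y * r" by simp
      then show ?thesis using False by (simp add: min_def nr algebra_simps)
    qed
    then show ?thesis by (simp add: r_def algebra_simps)
  qed
  with * show ?thesis by (simp add: n_def)
qed

text \<open>A farthest pair \<open>lo\<close>, \<open>hi\<close> of \<open>B\<close> makes the differences of \<open>B - {hi}\<close> distinct modulo \<open>hi - lo\<close>,
  by the parallelogram law.\<close>

lemma three_translates: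
  fixes B :: "'a::euclidean_space set" and Y :: "'i \<Rightarrow> 'a set"
  assumes "finite B" "B \<noteq> {}" "finite I" "\<And>i. i \<in> I \<Longrightarrow> finite (Y i)"
  obtains D where "D \<subseteq> B" "D \<noteq> {}" "card D \<le> 3"
    "(\<Sum>i\<in>I. card (Y i) + min (card (Y i)) (card B - 1)) \<le> (\<Sum>i\<in>I. card (Y i + D))"
proof (cases "card B = 1")
  case True
  then obtain b where "B = {b}" by (auto simp: card_1_singleton_iff)
  then show ?thesis by (intro that[of B]) (auto simp: card_translate)
next
  case False
  then have B2: "card B \<ge> 2" using False assms card_gt_0_iff[of B] by simp
  have "finite (B \<times> B)" "B \<times> B \<noteq> {}" using assms by auto
  then obtain pr where pr: "pr \<in> B \<times> B" "\<And>r. r \<in> B \<times> B \<Longrightarrow> dist (fst r) (snd r) \<le> dist (fst pr) (snd pr)"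
    using finite_has_maximizer[of "B \<times> B" "\<lambda>r. dist (fst r) (snd r)"] by blast
  define lo hi where "lo = fst pr" and "hi = snd pr"
  define m where "m = hi - lo"
  have lohi: "lo \<in> B" "hi \<in> B" using pr by (auto simp: lo_def hi_def)
  have far: "norm (b - b') \<le> norm m" if "b \<in> B" "b' \<in> B" for b b'
    using pr(2)[of "(b', b)"] that by (simp add: dist_norm m_def lo_def hi_def norm_minus_commute)
  have "m \<noteq> 0"
  proof
    assume "m = 0"
    then have "b = b'" if "b \<in> B" "b' \<in> B" for b b' using far[OF that] by simp
    then have "card B \<le> 1" using assms by (simp add: card_le_Suc0_iff_eq)
    with B2 show False by simp
  qed
  have one: "b' = lo" if "b \<in> B" "b' \<in> B" "b = b' + m" for b b'
  proof -
    define e where "e = b' - lo"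
    have "norm (e + m) \<le> norm m" using far[of b lo] that lohi by (simp add: e_def algebra_simps)
    moreover have "norm (e - m) \<le> norm m" using far[of b' hi] that lohi by (simp add: e_def m_def algebra_simps)
    moreover have "(norm (e + m))\<^sup>2 + (norm (e - m))\<^sup>2 = 2 * (norm e)\<^sup>2 + 2 * (norm m)\<^sup>2"
      by (simp add: power2_norm_eq_inner algebra_simps inner_commute)
    moreover have "(norm (e + m))\<^sup>2 \<le> (norm m)\<^sup>2" "(norm (e - m))\<^sup>2 \<le> (norm m)\<^sup>2"
      using calculation by (auto intro!: power_mono)
    ultimately have "(norm e)\<^sup>2 \<le> 0" by linarith
    then show ?thesis by (simp add: e_def)
  qed
  \<comment> \<open>\<open>far\<close> leaves only the multiples -1, 0 and 1 of \<open>m\<close>. In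
    the outer cases one of the two points is \<open>lo\<close> and the other \<open>lo + m\<close>,
    that is \<open>hi\<close>, which is excluded.\<close>
  have dist: "b = b'" if b: "b \<in> B - {hi}" "b' \<in> B - {hi}" "b - b' = of_int k *\<^sub>R m" for b b' and k :: int
  proof -
    have "\<bar>of_int k\<bar> * norm m \<le> 1 * norm m" using far[of b b'] that by simp
    then have "\<bar>real_of_int k\<bar> \<le> 1" using \<open>m \<noteq> 0\<close> by (simp only: mult_le_cancel_right) simp
    then have "k = 0 \<or> k = 1 \<or> k = -1" by linarith
    then show ?thesis
    proof (elim disjE)
      assume "k = 1"
      then have "b = b' + m" using b by (simp add: algebra_simps)
      moreover from this have "b' = lo" using one b by blast
      ultimately show ?thesis using b by (simp add: m_def)
    next
      assume "k = -1"
      then have "b' = b + m" using b by (simp add: algebra_simps)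
      moreover from this have "b = lo" using one b by blast
      ultimately show ?thesis using b by (simp add: m_def)
    qed (use b in simp)
  qed
  \<comment> \<open>The sum over \<open>I\<close> is taken before averaging over \<open>b\<close>,
    so that one and the same \<open>D\<close> serves all the sets \<open>Y i\<close>.\<close>
  define L where "L = (\<Sum>i\<in>I. card (Y i) + min (card (Y i)) (card B - 1))"
  have "(card B - 1) * L = (\<Sum>i\<in>I. (card B - 1) * (card (Y i) + min (card (Y i)) (card B - 1)))"
    by (simp add: L_def sum_distrib_left)
  also have "\<dots> \<le> (\<Sum>i\<in>I. \<Sum>b\<in>B - {hi}. card (Y i + {lo, hi, b}))"
    using assms lohi m_def \<open>m \<noteq> 0\<close> dist by (intro sum_mono sum_three_translates) auto
  also have "\<dots> = (\<Sum>b\<in>B - {hi}. \<Sum>i\<in>I. card (Y i + {lo, hi, b}))"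
    by (rule sum.swap)
  finally have *: "(card B - 1) * L \<le> (\<Sum>b\<in>B - {hi}. \<Sum>i\<in>I. card (Y i + {lo, hi, b}))" .
  have "\<exists>b\<in>B - {hi}. L \<le> (\<Sum>i\<in>I. card (Y i + {lo, hi, b}))"
  proof (rule ccontr)
    assume "\<not> ?thesis"
    then have "(\<Sum>b\<in>B - {hi}. \<Sum>i\<in>I. card (Y i + {lo, hi, b})) < (\<Sum>b\<in>B - {hi}. L)"
      using lohi \<open>m \<noteq> 0\<close> \<open>finite B\<close> by (intro sum_strict_mono) (auto simp: m_def not_le)
    also have "\<dots> = (card B - 1) * L" using lohi assms by simp
    finally show False using * by simp
  qed
  then obtain b where "b \<in> B - {hi}" "L \<le> (\<Sum>i\<in>I. card (Y i + {lo, hi, b}))" by blast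
  then show ?thesis using lohi by (intro that[of "{lo, hi, b}"]) (auto simp: L_def card_insert_if)
qed

text \<open>Greedy choice: a random element of \<open>B\<close> moves few points of \<open>Y\<close> into the sums already found.\<close>

lemma sparse_translates:
  fixes Y B :: "'a::ab_group_add set"
  assumes "finite Y" "finite B" "B \<noteq> {}" and c: "c > 0"
    and sparse: "\<And>a b'. a \<in> Y \<Longrightarrow> b' \<in> B \<Longrightarrow> real c * card {b \<in> B. a + b - b' \<in> Y} \<le> card B"
  obtains C where "C \<subseteq> B" "card C \<le> c" "real c / 2 * card Y \<le> card (Y + C)"
proof -
  \<comment> \<open>A further element gains at least \<open>(1 - i / c) * card Y\<close> when
    \<open>i\<close> are present. The coefficient is the sum of these gains; at \<open>i = c\<close>
    it is \<open>(c + 1) / 2\<close>.\<close>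
  have "i \<le> c \<Longrightarrow> \<exists>C\<subseteq>B. card C \<le> i \<and> (real i - real i * (real i - 1) / (2 * c)) * card Y \<le> card (Y + C)" for i
  proof (induction i)
    case 0
    show ?case by (rule exI[of _ "{}"]) simp
  next
    case (Suc i)
    then obtain C where C: "C \<subseteq> B" "card C \<le> i" "(real i - real i * (real i - 1) / (2 * c)) * card Y \<le> card (Y + C)"
      by auto
    have finC: "finite C" using C \<open>finite B\<close> finite_subset by auto
    have "(\<Sum>b\<in>B. card {a \<in> Y. a + b \<in> Y + C}) = (\<Sum>a\<in>Y. card {b \<in> B. a + b \<in> Y + C})"
      using assms by (intro sum_card_swap)
    also have "real \<dots> \<le> (\<Sum>a\<in>Y. i * (real (card B) / c))"
      unfolding of_nat_sum
    proof (rule sum_mono)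
      fix a assume a: "a \<in> Y"
      have "{b \<in> B. a + b \<in> Y + C} \<subseteq> (\<Union>b'\<in>C. {b \<in> B. a + b - b' \<in> Y})"
        by (force simp: set_plus_def)
      then have "card {b \<in> B. a + b \<in> Y + C} \<le> card (\<Union>b'\<in>C. {b \<in> B. a + b - b' \<in> Y})"
        using finC \<open>finite B\<close> by (intro card_mono) auto
      also have "\<dots> \<le> (\<Sum>b'\<in>C. card {b \<in> B. a + b - b' \<in> Y})"
        using finC by (rule card_UN_le)
      also have "real \<dots> \<le> (\<Sum>b'\<in>C. real (card B) / c)"
        unfolding of_nat_sum using C sparse[OF a] c by (intro sum_mono) (auto simp: field_simps)
      also have "\<dots> \<le> i * (real (card B) / c)"
        using C by (simp add: mult_right_mono divide_right_mono)
      finally show "real (card {b \<in> B. a + b \<in> Y + C}) \<le> i * (real (card B) / c)" by simp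
    qed
    also have "\<dots> = (\<Sum>b\<in>B. real i / c * card Y)" by simp
    finally have "(\<Sum>b\<in>B. real (card {a \<in> Y. a + b \<in> Y + C})) \<le> (\<Sum>b\<in>B. real i / c * card Y)" by simp
    then have "\<exists>b\<in>B. real (card {a \<in> Y. a + b \<in> Y + C}) \<le> real i / c * card Y"
      using sum_strict_mono[OF \<open>finite B\<close> \<open>B \<noteq> {}\<close>, of "\<lambda>b. real i / c * card Y"] by (meson linorder_not_less)
    then obtain b where b: "b \<in> B" "real (card {a \<in> Y. a + b \<in> Y + C}) \<le> real i / c * card Y" by blast
    have disj: "(Y + C) \<inter> ({a \<in> Y. a + b \<notin> Y + C} + {b}) = {}"
      by (auto simp: set_plus_def) (metis)
    have "card (Y + C) + card {a \<in> Y. a + b \<notin> Y + C} = card ((Y + C) \<union> ({a \<in> Y. a + b \<notin> Y + C} + {b}))"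
      using disj assms finC by (simp add: card_Un_disjoint finite_set_plus card_translate)
    also have "\<dots> \<le> card (Y + insert b C)"
      using assms finC by (intro card_mono finite_set_plus) (auto simp: set_plus_def)
    finally have 1: "card (Y + C) + card {a \<in> Y. a + b \<notin> Y + C} \<le> card (Y + insert b C)" .
    have 2: "card Y = card {a \<in> Y. a + b \<in> Y + C} + card {a \<in> Y. a + b \<notin> Y + C}"
      using \<open>finite Y\<close> by (subst card_Un_disjoint[symmetric]) (auto intro!: arg_cong[where f=card])
    have "(real (Suc i) - real (Suc i) * (real (Suc i) - 1) / (2 * c)) * card Y
       = (real i - real i * (real i - 1) / (2 * c)) * card Y + (card Y - real i / c * card Y)"
      using c by (simp add: field_simps)
    also have "\<dots> \<le> card (Y + insert b C)"
    proof -
      have "card Y - real i / c * card Y \<le> card {a \<in> Y. a + b \<notin> Y + C}"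
        using 2 b(2) by linarith
      from add_mono[OF C(3) this] show ?thesis
        by (rule order_trans) (use 1 in linarith)
    qed
    finally show ?case
      using C b finC by (intro exI[of _ "insert b C"]) (auto simp: card_insert_if)
  qed
  from this[OF order_refl] obtain C where C: "C \<subseteq> B" "card C \<le> c"
    "(real c - real c * (real c - 1) / (2 * c)) * card Y \<le> card (Y + C)" by blast
  have "real c / 2 \<le> real c - real c * (real c - 1) / (2 * c)" using c by (simp add: field_simps)
  then have "real c / 2 * card Y \<le> (real c - real c * (real c - 1) / (2 * c)) * card Y"
    by (intro mult_right_mono) auto
  then show ?thesis using that C by force
qed

section \<open>A direction with few lines\<close>

text \<open>Lists with repetition rather than subsets: concatenation matches pairs of
  \<open>m\<close>-tuples with \<open>2 * m\<close>-tuples, and an entrywise shift preserves the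
  length, so that both averaging and pigeonhole become exact counts.\<close>

definition tuples :: "nat \<Rightarrow> 'a set \<Rightarrow> 'a list set" where
  "tuples m A = {xs. set xs \<subseteq> A \<and> length xs = m}"

lemma finite_tuples: "finite A \<Longrightarrow> finite (tuples m A)"
  and card_tuples: "finite A \<Longrightarrow> card (tuples m A) = card A ^ m"
  by (simp_all add: tuples_def finite_lists_length_eq card_lists_length_eq)

lemma sum_tuples_add:
  "(\<Sum>zs\<in>tuples (m + k) A. h zs) = (\<Sum>xs\<in>tuples m A. \<Sum>ys\<in>tuples k A. h (xs @ ys))"
proof -
  have "(\<Sum>xs\<in>tuples m A. \<Sum>ys\<in>tuples k A. h (xs @ ys)) = (\<Sum>p\<in>tuples m A \<times> tuples k A. h (fst p @ snd p))"
    by (simp add: sum.cartesian_product case_prod_beta')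
  also have "\<dots> = (\<Sum>zs\<in>tuples (m + k) A. h zs)"
  proof (rule sum.reindex_bij_witness[of _ "\<lambda>zs. (take m zs, drop m zs)" "\<lambda>p. fst p @ snd p"])
    show "(take m zs, drop m zs) \<in> tuples m A \<times> tuples k A" if "zs \<in> tuples (m + k) A" for zs
      using that set_take_subset[of m zs] set_drop_subset[of m zs] by (auto simp: tuples_def)
  qed (auto simp: tuples_def)
  finally show ?thesis by simp
qed

text \<open>The average of \<open>card (A + set xs)\<close> over \<open>m\<close>-tuples is bounded, so it hardly increases for some
  doubling of \<open>m\<close>.\<close>

lemma stable_tuple_length:
  fixes A :: "'a::ab_group_add set" and K :: real
  assumes A: "finite A" "A \<noteq> {}" and n: "n > 0"
    and small: "\<And>C. C \<subseteq> A \<Longrightarrow> C \<noteq> {} \<Longrightarrow> card C \<le> 2 ^ n \<Longrightarrow> card (A + C) \<le> K * card A"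
  obtains m where "m \<ge> 1" "m \<le> 2 ^ n"
    "(\<Sum>xs\<in>tuples m A. \<Sum>ys\<in>tuples m A. real (card ((A + set xs) - (A + set ys))))
       \<le> K / n * card A * (real (card A) ^ m)\<^sup>2"
proof -
  define E where "E m = (\<Sum>xs\<in>tuples m A. real (card (A + set xs))) / real (card A) ^ m" for m
  define D where "D m = (\<Sum>xs\<in>tuples m A. \<Sum>ys\<in>tuples m A. real (card ((A + set xs) - (A + set ys))))
      / (real (card A) ^ m)\<^sup>2" for m
  have A0: "real (card A) > 0" using A by (simp add: card_gt_0_iff)
  \<comment> \<open>\<open>D m\<close> is the average number of sums that an independent second
    tuple adds. Telescoping over \<open>n\<close> doublings bounds the total of these increments by
    \<open>K * card A\<close>, so one of them is at most an \<open>n\<close>-th of it.\<close>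
  have ED: "E (2 * m) = E m + D m" for m
  proof -
    have split: "real (card (A + set (xs @ ys))) = real (card (A + set ys)) + real (card ((A + set xs) - (A + set ys)))"
      for xs ys
    proof -
      have "A + set (xs @ ys) = (A + set ys) \<union> ((A + set xs) - (A + set ys))"
        by (auto simp: set_plus_def)
      moreover have "card \<dots> = card (A + set ys) + card ((A + set xs) - (A + set ys))"
        using A by (intro card_Un_disjoint) (auto intro: finite_set_plus)
      ultimately show ?thesis by simp
    qed
    have "(\<Sum>zs\<in>tuples (m + m) A. real (card (A + set zs)))
       = (\<Sum>xs\<in>tuples m A. \<Sum>ys\<in>tuples m A. real (card (A + set ys)))
        + (\<Sum>xs\<in>tuples m A. \<Sum>ys\<in>tuples m A. real (card ((A + set xs) - (A + set ys))))"
      unfolding sum_tuples_add split by (simp add: sum.distrib)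
    also have "(\<Sum>xs\<in>tuples m A. \<Sum>ys\<in>tuples m A. real (card (A + set ys)))
       = real (card A) ^ m * (\<Sum>ys\<in>tuples m A. real (card (A + set ys)))"
      using A by (simp add: card_tuples)
    finally have "E (m + m) = (real (card A) ^ m * (\<Sum>ys\<in>tuples m A. real (card (A + set ys)))
        + (\<Sum>xs\<in>tuples m A. \<Sum>ys\<in>tuples m A. real (card ((A + set xs) - (A + set ys))))) / (real (card A) ^ m)\<^sup>2"
      by (simp add: E_def power_add power2_eq_square)
    also have "\<dots> = E m + D m"
      using A0 by (simp add: E_def D_def add_divide_distrib power2_eq_square)
    finally show ?thesis by (simp add: mult_2)
  qed
  have E0: "E m \<ge> 0" for m by (simp add: E_def sum_nonneg)
  have "(\<Sum>i<n. D (2 ^ i)) = (\<Sum>i<n. E (2 ^ Suc i) - E (2 ^ i))"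
    using ED by (intro sum.cong) auto
  also have "\<dots> = E (2 ^ n) - E (2 ^ 0)" by (rule sum_lessThan_telescope)
  also have "\<dots> \<le> E (2 ^ n)" using E0 by simp
  also have "E (2 ^ n) \<le> K * card A"
  proof -
    have "(\<Sum>xs\<in>tuples (2 ^ n) A. real (card (A + set xs))) \<le> (\<Sum>xs\<in>tuples (2 ^ n) A. K * card A)"
    proof (intro sum_mono small)
      fix xs assume "xs \<in> tuples (2 ^ n) A"
      then have "set xs \<subseteq> A" "length xs = 2 ^ n" by (auto simp: tuples_def)
      moreover from this have "xs \<noteq> []" by auto
      ultimately show "set xs \<subseteq> A" "set xs \<noteq> {}" "card (set xs) \<le> 2 ^ n"
        using card_length[of xs] by auto
    qed
    also have "\<dots> = real (card A) ^ (2 ^ n) * (K * card A)" using A by (simp add: card_tuples)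
    finally show ?thesis using A0 by (simp add: E_def divide_le_eq mult_ac)
  qed
  finally have *: "(\<Sum>i<n. D (2 ^ i)) \<le> (\<Sum>i<n. K * card A / n)" using n by simp
  have "\<exists>i<n. D (2 ^ i) \<le> K * card A / n"
  proof (rule ccontr)
    assume "\<not> ?thesis"
    then have "(\<Sum>i<n. D (2 ^ i)) > (\<Sum>i<n. K * card A / n)"
      using n by (intro sum_strict_mono) (auto simp: not_le)
    with * show False by simp
  qed
  then obtain i where i: "i < n" "D (2 ^ i) \<le> K * card A / n" by blast
  show ?thesis
  proof (rule that[of "2 ^ i"])
    show "(2::nat) ^ i \<le> 2 ^ n" using i by simp
    show "(\<Sum>xs\<in>tuples (2 ^ i) A. \<Sum>ys\<in>tuples (2 ^ i) A. real (card ((A + set xs) - (A + set ys))))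
       \<le> K / n * card A * (real (card A) ^ 2 ^ i)\<^sup>2"
      using i(2) A0 by (simp add: D_def divide_le_eq)
  qed simp
qed

text \<open>In each fibre of \<open>f\<close> that meets \<open>D\<close>, the point furthest in
  direction \<open>x\<close> leaves \<open>D\<close> under the shift by \<open>x\<close>, but stays
  in its fibre.\<close>

lemma card_linear_image_le:
  fixes D :: "'a::real_inner set"
  assumes D: "finite D" and x: "x \<noteq> 0" and f: "linear f" "f x = 0"
  shows "card (f ` D) \<le> card (((\<lambda>d. d + x) ` D) - D)"
proof -
  have "f ` D \<subseteq> f ` (((\<lambda>d. d + x) ` D) - D)"
  proof
    fix v assume "v \<in> f ` D"
    then have "finite {d \<in> D. f d = v}" "{d \<in> D. f d = v} \<noteq> {}" using D by auto
    from finite_has_maximizer[OF this, of "\<lambda>d. d \<bullet> x"]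
    obtain d where d: "d \<in> D" "f d = v" "\<And>e. e \<in> D \<Longrightarrow> f e = v \<Longrightarrow> e \<bullet> x \<le> d \<bullet> x" by blast
    have v: "f (d + x) = v" using f d by (simp add: linear_add)
    have "d + x \<notin> D"
    proof
      assume "d + x \<in> D"
      from d(3)[OF this v] have "x \<bullet> x \<le> 0" by (simp add: inner_add_left)
      with inner_ge_zero[of x] have "x \<bullet> x = 0" by linarith
      then show False using x by simp
    qed
    then show "v \<in> f ` (((\<lambda>d. d + x) ` D) - D)" using d(1) v by (intro image_eqI[of _ _ "d + x"]) auto
  qed
  then have "card (f ` D) \<le> card (f ` (((\<lambda>d. d + x) ` D) - D))" using D by (intro card_mono) auto
  also have "\<dots> \<le> card (((\<lambda>d. d + x) ` D) - D)" using D by (intro card_image_le) auto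
  finally show ?thesis .
qed

text \<open>Most \<open>m\<close>-tuples span nearly the same sumset with \<open>A\<close>; by the pigeonhole principle two of them are
  translates of each other, and the translation vector is an almost period of that sumset.\<close>

lemma almost_period:
  fixes A S :: "'a::ab_group_add set" and \<delta> :: real
  assumes A: "finite A" "A \<noteq> {}" and m: "m \<ge> 1" and d: "\<delta> > 0"
    and avg: "(\<Sum>xs\<in>tuples m A. \<Sum>ys\<in>tuples m A. real (card ((A + set xs) - (A + set ys))))
       \<le> \<delta> * card A * (real (card A) ^ m)\<^sup>2"
    and S: "S \<subseteq> A" "real (card (A + S)) ^ m < card S * real (card A) ^ m / 2"
  obtains x D a0 where "x \<noteq> 0" "finite D" "a0 \<in> A" "(\<lambda>a. a + a0) ` A \<subseteq> D"
    "card (((\<lambda>d. d + x) ` D) - D) \<le> 8 * \<delta> * card A"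
proof -
  define N where "N = real (card A) ^ m"
  define g where "g xs ys = real (card ((A + set xs) - (A + set ys)))" for xs ys :: "'a list"
  have A0: "real (card A) > 0" using A by (simp add: card_gt_0_iff)
  have N0: "N > 0" using A0 by (simp add: N_def)
  have finW: "finite (tuples m A)" and cardW: "real (card (tuples m A)) = N"
    using A by (simp_all add: finite_tuples card_tuples N_def)
  have Wne: "tuples m A \<noteq> {}" using cardW N0 by auto
  have "(\<Sum>ys\<in>tuples m A. \<Sum>xs\<in>tuples m A. g xs ys + g ys xs) \<le> 2 * (\<delta> * card A * N\<^sup>2)"
    using avg sum.swap[of "\<lambda>xs ys. g xs ys" "tuples m A" "tuples m A"]
    by (simp add: sum.distrib g_def N_def)
  also have "\<dots> = (\<Sum>ys\<in>tuples m A. 2 * \<delta> * card A * N)"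
    using cardW by (simp add: power2_eq_square)
  finally have "\<exists>ys\<in>tuples m A. (\<Sum>xs\<in>tuples m A. g xs ys + g ys xs) \<le> 2 * \<delta> * card A * N"
    using sum_strict_mono[OF finW Wne, of "\<lambda>_. 2 * \<delta> * card A * N"] by (meson linorder_not_less)
  then obtain zs where zs: "zs \<in> tuples m A" "(\<Sum>xs\<in>tuples m A. g xs zs + g zs xs) \<le> 2 * \<delta> * card A * N"
    by blast
  \<comment> \<open>By Markov's inequality at least half of all tuples are this close to
    \<open>zs\<close>. Comparing with one central tuple bounds the difference of any two members of
    \<open>G\<close> by \<open>8 * \<delta> * card A\<close>.\<close>
  define G where "G = {xs \<in> tuples m A. g xs zs + g zs xs \<le> 4 * \<delta> * card A}"
  have "card (tuples m A - G) * (4 * \<delta> * card A) \<le> (\<Sum>xs\<in>tuples m A - G. g xs zs + g zs xs)"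
    by (rule sum_bounded_below) (auto simp: G_def)
  also have "\<dots> \<le> (\<Sum>xs\<in>tuples m A. g xs zs + g zs xs)"
    using finW by (intro sum_mono2) (auto simp: g_def)
  also have "\<dots> \<le> 2 * \<delta> * card A * N" by (rule zs(2))
  also have "\<dots> = (N / 2) * (4 * \<delta> * card A)" by simp
  finally have "card (tuples m A - G) * (4 * \<delta> * card A) \<le> (N / 2) * (4 * \<delta> * card A)" .
  then have "card (tuples m A - G) \<le> N / 2" using d A0 by (simp add: mult_le_cancel_right)
  moreover have "card (tuples m A) = card (tuples m A - G) + card G"
  proof -
    have sub: "G \<subseteq> tuples m A" by (auto simp: G_def)
    then have "finite G" using finW finite_subset by blast
    then show ?thesis using card_Diff_subset[OF _ sub] card_mono[OF finW sub] by simp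
  qed
  ultimately have G: "card G \<ge> N / 2" using cardW by linarith
  \<comment> \<open>By \<open>S(2)\<close> there are fewer \<open>m\<close>-tuples over
    \<open>A + S\<close> than pairs of a shift from \<open>S\<close> and a tuple from
    \<open>G\<close>. Equal shifts would force equal tuples, so a collision has
    \<open>x \<noteq> 0\<close>.\<close>
  define F where "F p = map (\<lambda>z. z + fst p) (snd p)" for p :: "'a \<times> 'a list"
  have finS: "finite S" using S A finite_subset by auto
  have FS: "F ` (S \<times> G) \<subseteq> tuples m (A + S)"
    by (auto simp: F_def G_def tuples_def set_plus_def) blast
  have "real (card (tuples m (A + S))) < card S * (N / 2)"
    using S(2) A finS by (simp add: card_tuples finite_set_plus N_def)
  also have "\<dots> \<le> card S * card G" unfolding of_nat_mult using G by (intro mult_left_mono) auto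
  also have "\<dots> = card (S \<times> G)" by (simp add: card_cartesian_product)
  finally have "card (tuples m (A + S)) < card (S \<times> G)" by linarith
  then have "\<not> inj_on F (S \<times> G)"
    using card_inj_on_le[of F "S \<times> G", OF _ FS] A finS by (auto simp: finite_tuples finite_set_plus)
  then obtain s xs t ys where st: "xs \<in> G" "ys \<in> G" "F (s, xs) = F (t, ys)" "(s, xs) \<noteq> (t, ys)"
    unfolding inj_on_def by blast
  define x where "x = s - t"
  have ys: "ys = map (\<lambda>z. z + x) xs"
  proof -
    have "map (\<lambda>z. z - t) (F (s, xs)) = map (\<lambda>z. z - t) (F (t, ys))" using st by simp
    then show ?thesis by (simp add: F_def x_def comp_def algebra_simps)
  qed
  have x: "x \<noteq> 0"
  proof
    assume "x = 0"
    then show False using st(4) ys by (simp add: x_def)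
  qed
  define D where "D = A + set xs"
  have Dx: "(\<lambda>d. d + x) ` D = A + set ys"
    by (auto simp: D_def ys set_plus_def image_iff algebra_simps) blast+
  have fin: "finite (A + set us)" for us using A by (simp add: finite_set_plus)
  have "card ((A + set ys) - D) \<le> card (((A + set ys) - (A + set zs)) \<union> ((A + set zs) - (A + set xs)))"
    using fin by (intro card_mono) (auto simp: D_def)
  also have "\<dots> \<le> card ((A + set ys) - (A + set zs)) + card ((A + set zs) - (A + set xs))"
    by (rule card_Un_le)
  finally have "real (card ((A + set ys) - D)) \<le> g ys zs + g zs xs" by (simp add: g_def flip: of_nat_add)
  also have "\<dots> \<le> (g ys zs + g zs ys) + (g xs zs + g zs xs)" by (simp add: g_def)
  also have "\<dots> \<le> 8 * \<delta> * card A" using st by (simp add: G_def)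
  finally have *: "card (((\<lambda>d. d + x) ` D) - D) \<le> 8 * \<delta> * card A" by (simp add: Dx)
  have "xs \<noteq> []" "set xs \<subseteq> A" using st(1) m by (auto simp: G_def tuples_def)
  then obtain a1 where a1: "a1 \<in> set xs" "a1 \<in> A" by (cases xs) auto
  have "(\<lambda>a. a + a1) ` A \<subseteq> D" using a1 by (auto simp: D_def)
  with that[OF x _ a1(2) _ *] fin[of xs] show ?thesis by (simp add: D_def)
qed

text \<open>Up to translation \<open>A\<close> lies in a set \<open>D\<close> with an almost period
  \<open>x\<close>. By \<open>card_linear_image_le\<close>, the fibres that \<open>D\<close> meets
  for a linear map vanishing at \<open>x\<close> are at most as many as the points by which the
  shift of \<open>D\<close> exceeds \<open>D\<close>.\<close>

lemma direction_with_few_lines: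
  fixes K \<epsilon> :: real
  assumes K: "K \<ge> 1" and e: "\<epsilon> > 0"
  shows "\<exists>c\<ge>1. \<forall>A :: 'a::euclidean_space set. finite A \<longrightarrow> card A \<ge> c \<longrightarrow>
    (\<forall>C\<subseteq>A. C \<noteq> {} \<longrightarrow> card C \<le> c \<longrightarrow> card (A + C) \<le> K * card A) \<longrightarrow>
    (\<exists>x. x \<noteq> 0 \<and> (\<forall>f :: 'a \<Rightarrow> 'a. linear f \<longrightarrow> f x = 0 \<longrightarrow> card (f ` A) \<le> \<epsilon> * card A))"
proof -
  \<comment> \<open>Among \<open>n\<close> doublings one has average increment at most
    \<open>K / n\<close> relative to \<open>card A\<close>; \<open>almost_period\<close> multiplies
    this by 8.\<close>
  define n where "n = nat \<lceil>8 * K / \<epsilon>\<rceil>"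
  have n: "n \<ge> 8 * K / \<epsilon>" by (simp add: n_def real_nat_ceiling_ge)
  moreover have "8 * K / \<epsilon> > 0" using K e by simp
  ultimately have n0: "n > 0" by simp
  \<comment> \<open>\<open>K ^ (2 ^ n)\<close> bounds the \<open>m\<close>-th power of
    \<open>card (A + S) / card A\<close> for all \<open>m \<le> 2 ^ n\<close>, so a set of this size
    forces a collision whichever length is found.\<close>
  define s where "s = nat \<lceil>2 * K ^ (2 ^ n)\<rceil> + 1"
  have s: "s > 2 * K ^ (2 ^ n)" unfolding s_def by linarith
  show ?thesis
  proof (intro exI[of _ "max (2 ^ n) s"] conjI allI impI)
    fix A :: "'a set" assume A: "finite A" "max (2 ^ n) s \<le> card A"
      and small: "\<forall>C\<subseteq>A. C \<noteq> {} \<longrightarrow> card C \<le> max (2 ^ n) s \<longrightarrow> card (A + C) \<le> K * card A"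
    have A0: "real (card A) > 0" "A \<noteq> {}" using A(2) by (auto simp: s_def)
    have small': "card (A + C) \<le> K * card A" if "C \<subseteq> A" "C \<noteq> {}" "card C \<le> 2 ^ n" for C
      using small that by simp
    obtain m where m: "m \<ge> 1" "m \<le> 2 ^ n"
      "(\<Sum>xs\<in>tuples m A. \<Sum>ys\<in>tuples m A. real (card ((A + set xs) - (A + set ys))))
       \<le> K / n * card A * (real (card A) ^ m)\<^sup>2"
      using stable_tuple_length[OF A(1) A0(2) n0 small'] by blast
    obtain S where S: "S \<subseteq> A" "card S = s" using obtain_subset_with_card_n[of s A] A(2) by auto
    have "card (A + S) \<le> K * card A" using small S by (auto simp: s_def)
    then have "real (card (A + S)) ^ m \<le> (K * card A) ^ m" by (intro power_mono) auto
    also have "\<dots> = K ^ m * real (card A) ^ m" by (rule power_mult_distrib)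
    also have "\<dots> \<le> K ^ (2 ^ n) * real (card A) ^ m"
      using m(2) K by (intro mult_right_mono power_increasing) auto
    also have "\<dots> < s / 2 * real (card A) ^ m"
      using s A0 by (intro mult_strict_right_mono) auto
    finally have S2: "real (card (A + S)) ^ m < card S * real (card A) ^ m / 2" using S by simp
    have "K / n > 0" using K n0 by simp
    then obtain x D a0 where x: "x \<noteq> 0" "finite D" "(\<lambda>a. a + a0) ` A \<subseteq> D"
      "card (((\<lambda>d. d + x) ` D) - D) \<le> 8 * (K / n) * card A"
      using almost_period[OF A(1) A0(2) m(1) _ m(3) S(1) S2] by metis
    have "card (f ` A) \<le> \<epsilon> * card A" if f: "linear f" "f x = 0" for f :: "'a \<Rightarrow> 'a"
    proof -
      have "f ` A \<subseteq> (\<lambda>v. v - f a0) ` f ` D"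
      proof
        fix v assume "v \<in> f ` A"
        then obtain a where a: "a \<in> A" "v = f a" by blast
        then have "f (a + a0) \<in> f ` D" using x(3) by blast
        moreover have "v = f (a + a0) - f a0" using a by (simp add: linear_add[OF f(1)])
        ultimately show "v \<in> (\<lambda>v. v - f a0) ` f ` D" by blast
      qed
      then have "card (f ` A) \<le> card (f ` D)"
        using x(2) by (meson card_image_le card_mono finite_imageI order_trans)
      also have "\<dots> \<le> card (((\<lambda>d. d + x) ` D) - D)"
        using card_linear_image_le[OF x(2,1) f] .
      also have "real \<dots> \<le> (8 * K / n) * card A" using x(4) by simp
      also have "\<dots> \<le> \<epsilon> * card A" using n n0 e by (intro mult_right_mono) (auto simp: field_simps)
      finally show ?thesis by simp
    qed
    then show "\<exists>x. x \<noteq> 0 \<and> (\<forall>f :: 'a \<Rightarrow> 'a. linear f \<longrightarrow> f x = 0 \<longrightarrow> card (f ` A) \<le> \<epsilon> * card A)"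
      using x(1) by blast
  qed (simp add: s_def)
qed

section \<open>Expansion of nondegenerate sets\<close>

text \<open>Double counting: an element \<open>s\<close> lies only in levels up to
  \<open>j s\<close>, hence in at most \<open>j s\<close> of them.\<close>

lemma sum_level_counts:
  fixes S :: "'s set" and L :: "nat \<Rightarrow> 's set"
  assumes "finite S" and "\<And>i. i \<in> {1..n} \<Longrightarrow> L i \<subseteq> S"
    and j: "\<And>s i. s \<in> S \<Longrightarrow> i \<in> {1..n} \<Longrightarrow> s \<in> L i \<Longrightarrow> i \<le> j s"
  shows "(\<Sum>i\<in>{1..n}. card (L i)) \<le> (\<Sum>s\<in>S. j s)"
proof -
  have "(\<Sum>i\<in>{1..n}. card (L i)) = (\<Sum>i\<in>{1..n}. card {s \<in> S. s \<in> L i})"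
    using assms(2) by (intro sum.cong arg_cong[where f=card]) blast+
  also have "\<dots> = (\<Sum>s\<in>S. card {i \<in> {1..n}. s \<in> L i})"
    using \<open>finite S\<close> by (intro sum_card_swap) auto
  also have "\<dots> \<le> (\<Sum>s\<in>S. j s)"
  proof (rule sum_mono)
    fix s assume "s \<in> S"
    then have "{i \<in> {1..n}. s \<in> L i} \<subseteq> {1..j s}" using j by auto
    then show "card {i \<in> {1..n}. s \<in> L i} \<le> j s" using card_mono[of "{1..j s}"] by simp
  qed
  finally show ?thesis .
qed

text \<open>Each element \<open>s\<close> of the sumset of the projections is charged to its highest level \<open>j s\<close>, where it is a
  sum of two points whose fibres have at least \<open>j s * l\<close> elements.\<close>

lemma sumset_from_levels:
  fixes X :: "'a::euclidean_space set" and p :: "'a \<Rightarrow> 'a" and l :: real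
  assumes X: "finite X" and p: "linear p" and l: "l \<ge> 0"
  defines "T \<equiv> \<lambda>i::nat. {t \<in> p ` X. real i * l \<le> card {a \<in> X. p a = t}}"
  assumes C: "\<And>i. i \<in> {1..n} \<Longrightarrow> C i \<subseteq> T i \<and> card (C i) \<le> c"
  obtains D where "D \<subseteq> X" "card D \<le> 3 * (n * c)"
    "2 * l * (\<Sum>i\<in>{1..n}. card (T i + C i)) - n * c * card (p ` X) \<le> card (X + D)"
proof -
  define w where "w t = {a \<in> X. p a = t}" for t
  have finT: "finite (T i)" for i using X by (simp add: T_def)
  have finC: "finite (C i)" if "i \<in> {1..n}" for i using C[OF that] finT finite_subset by blast
  have finw: "finite (w t)" for t using X by (simp add: w_def)
  define S where "S = (\<Union>i\<in>{1..n}. T i + C i)"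
  have finS: "finite S" using finT finC by (auto simp: S_def intro: finite_set_plus)
  define U where "U = (\<Union>i\<in>{1..n}. C i)"
  have finU: "finite U" using finC by (auto simp: U_def)
  have cardU: "card U \<le> n * c"
  proof -
    have "card U \<le> (\<Sum>i\<in>{1..n}. card (C i))" unfolding U_def by (rule card_UN_le) simp
    also have "\<dots> \<le> (\<Sum>i\<in>{1..n}. c)" using C by (intro sum_mono) auto
    finally show ?thesis by simp
  qed
  \<comment> \<open>Every \<open>s\<close> loses one element in \<open>three_translates\<close>, so
    \<open>card S\<close> is the total error; it is small when \<open>X\<close> meets few
    lines.\<close>
  have cardS: "card S \<le> n * c * card (p ` X)"
  proof -
    have "card (T i + C i) \<le> c * card (p ` X)" if "i \<in> {1..n}" for i
    proof -
      have "T i + C i = (\<lambda>(a, b). a + b) ` (T i \<times> C i)" by (auto simp: set_plus_def)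
      then have "card (T i + C i) \<le> card (T i) * card (C i)"
        using finT finC[OF that] by (metis card_cartesian_product card_image_le finite_cartesian_product)
      also have "\<dots> \<le> card (p ` X) * c"
        using C[OF that] X by (intro mult_le_mono card_mono) (auto simp: T_def)
      finally show ?thesis by (simp add: mult.commute)
    qed
    then have "(\<Sum>i\<in>{1..n}. card (T i + C i)) \<le> (\<Sum>i\<in>{1..n}. c * card (p ` X))" by (rule sum_mono)
    moreover have "card S \<le> (\<Sum>i\<in>{1..n}. card (T i + C i))" unfolding S_def by (rule card_UN_le) simp
    ultimately show ?thesis by simp
  qed
  define j where "j s = Max {i \<in> {1..n}. s \<in> T i + C i}" for s
  have jS: "j s \<in> {1..n} \<and> s \<in> T (j s) + C (j s)" if "s \<in> S" for s
  proof -
    have "{i \<in> {1..n}. s \<in> T i + C i} \<noteq> {}" using that by (auto simp: S_def)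
    then have "j s \<in> {i \<in> {1..n}. s \<in> T i + C i}" unfolding j_def by (intro Max_in) auto
    then show ?thesis by blast
  qed
  have jmax: "i \<le> j s" if "i \<in> {1..n}" "s \<in> T i + C i" for i s
    unfolding j_def using that by (intro Max_ge) auto
  have "\<exists>t u. t \<in> T (j s) \<and> u \<in> C (j s) \<and> s = t + u" if "s \<in> S" for s
    using jS[OF that] by (auto simp: set_plus_def)
  then obtain t u where tu: "\<And>s. s \<in> S \<Longrightarrow> t s \<in> T (j s) \<and> u s \<in> C (j s) \<and> s = t s + u s"
    by metis
  have uU: "u s \<in> U" if "s \<in> S" for s using tu[OF that] jS[OF that] by (auto simp: U_def)
  have uT: "u s \<in> T (j s)" if "s \<in> S" for s using tu[OF that] jS[OF that] C by blast
  \<comment> \<open>The \<open>s\<close> are grouped by their second summand \<open>v\<close>. A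
    single set of at most three elements over \<open>v\<close> serves the whole group, so the number
    of summands depends on \<open>U\<close> and not on \<open>S\<close>.\<close>
  have "\<exists>D\<subseteq>w v. card D \<le> 3 \<and>
      (\<Sum>s\<in>{s\<in>S. u s = v}. card (w (t s)) + min (card (w (t s))) (card (w v) - 1))
        \<le> (\<Sum>s\<in>{s\<in>S. u s = v}. card (w (t s) + D))" if "v \<in> U" for v
  proof -
    have "v \<in> p ` X" using that C unfolding U_def T_def by blast
    then have "w v \<noteq> {}" by (auto simp: w_def)
    moreover have "finite {s\<in>S. u s = v}" using finS by simp
    ultimately obtain D where "D \<subseteq> w v" "card D \<le> 3"
      "(\<Sum>s\<in>{s\<in>S. u s = v}. card (w (t s)) + min (card (w (t s))) (card (w v) - 1))
        \<le> (\<Sum>s\<in>{s\<in>S. u s = v}. card (w (t s) + D))"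
      by (rule three_translates[OF finw _ _ finw])
    then show ?thesis by blast
  qed
  then have "\<forall>v\<in>U. \<exists>D. D \<subseteq> w v \<and> card D \<le> 3 \<and>
      (\<Sum>s\<in>{s\<in>S. u s = v}. card (w (t s)) + min (card (w (t s))) (card (w v) - 1))
        \<le> (\<Sum>s\<in>{s\<in>S. u s = v}. card (w (t s) + D))" by (rule ballI)
  from bchoice[OF this] obtain D where D: "\<And>v. v \<in> U \<Longrightarrow> D v \<subseteq> w v" "\<And>v. v \<in> U \<Longrightarrow> card (D v) \<le> 3"
    "\<And>v. v \<in> U \<Longrightarrow> (\<Sum>s\<in>{s\<in>S. u s = v}. card (w (t s)) + min (card (w (t s))) (card (w v) - 1))
        \<le> (\<Sum>s\<in>{s\<in>S. u s = v}. card (w (t s) + D v))" by blast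
  define E where "E = (\<Union>v\<in>U. D v)"
  have EX: "E \<subseteq> X" using D(1) by (auto simp: E_def w_def)
  have "card E \<le> (\<Sum>v\<in>U. card (D v))" unfolding E_def by (rule card_UN_le[OF finU])
  also have "\<dots> \<le> (\<Sum>v\<in>U. 3)" using D(2) by (intro sum_mono) auto
  also have "\<dots> \<le> 3 * (n * c)" using cardU by simp
  finally have cardE: "card E \<le> 3 * (n * c)" .
  have val: "2 * l * j s - 1 \<le> real (card (w (t s)) + min (card (w (t s))) (card (w (u s)) - 1))"
    if "s \<in> S" for s
  proof -
    have t: "j s * l \<le> card (w (t s))" using tu[OF that] by (simp add: T_def w_def)
    have "u s \<in> p ` X" and u: "j s * l \<le> card (w (u s))" using uT[OF that] by (simp_all add: T_def w_def)
    then have "card (w (u s)) \<ge> 1" using finw[of "u s"] by (auto simp: w_def Suc_le_eq card_gt_0_iff)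
    then have "real (card (w (u s)) - 1) = real (card (w (u s))) - 1" by simp
    then have min: "j s * l - 1 \<le> real (min (card (w (t s))) (card (w (u s)) - 1))"
      using t u by (simp add: min_def)
    have "2 * l * j s - 1 = j s * l + (j s * l - 1)" by simp
    then show ?thesis unfolding of_nat_add using add_mono[OF t min] by simp
  qed
  have "2 * l * (\<Sum>i\<in>{1..n}. card (T i + C i)) \<le> 2 * l * (\<Sum>s\<in>S. j s)"
  proof -
    have "(\<Sum>i\<in>{1..n}. card (T i + C i)) \<le> (\<Sum>s\<in>S. j s)"
      using finS jmax by (intro sum_level_counts) (auto simp: S_def)
    then have "real (\<Sum>i\<in>{1..n}. card (T i + C i)) \<le> real (\<Sum>s\<in>S. j s)" by (rule of_nat_mono)
    then show ?thesis using l by (intro mult_left_mono) auto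
  qed
  also have "\<dots> = (\<Sum>s\<in>S. 2 * l * j s - 1) + card S"
    by (simp add: sum_distrib_left sum_subtractf)
  also have "(\<Sum>s\<in>S. 2 * l * j s - 1) \<le> (\<Sum>s\<in>S. real (card (w (t s)) + min (card (w (t s))) (card (w (u s)) - 1)))"
    by (intro sum_mono val)
  also have "\<dots> = real (\<Sum>s\<in>S. card (w (t s)) + min (card (w (t s))) (card (w (u s)) - 1))"
    by (simp only: of_nat_sum)
  also have "(\<Sum>s\<in>S. card (w (t s)) + min (card (w (t s))) (card (w (u s)) - 1))
      = (\<Sum>v\<in>U. \<Sum>s\<in>{s\<in>S. u s = v}. card (w (t s)) + min (card (w (t s))) (card (w (u s)) - 1))"
    using uU by (intro sum.group[OF finS finU, symmetric]) auto
  also have "\<dots> \<le> real (\<Sum>v\<in>U. \<Sum>s\<in>{s\<in>S. u s = v}. card (w (t s) + D (u s)))"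
  proof (rule of_nat_mono, rule sum_mono)
    fix v assume "v \<in> U"
    from D(3)[OF this] show "(\<Sum>s\<in>{s\<in>S. u s = v}. card (w (t s)) + min (card (w (t s))) (card (w (u s)) - 1))
      \<le> (\<Sum>s\<in>{s\<in>S. u s = v}. card (w (t s) + D (u s)))" by (simp cong: sum.cong_simp)
  qed
  also have "(\<Sum>v\<in>U. \<Sum>s\<in>{s\<in>S. u s = v}. card (w (t s) + D (u s))) = (\<Sum>s\<in>S. card (w (t s) + D (u s)))"
    using uU by (intro sum.group[OF finS finU]) auto
  also have "\<dots> \<le> card (X + E)"
  proof (rule card_fibre_sums[where q = p])
    show "finite E" using EX X finite_subset by blast
    fix s assume s: "s \<in> S"
    show "w (t s) \<subseteq> X" by (auto simp: w_def)
    show "D (u s) \<subseteq> E" using uU[OF s] by (auto simp: E_def)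
    fix a b assume "a \<in> w (t s)" "b \<in> D (u s)"
    moreover from this have "b \<in> w (u s)" using D(1)[OF uU[OF s]] by blast
    ultimately show "p (a + b) = s" using tu[OF s] p by (simp add: w_def linear_add)
  qed (use X finS in auto)
  finally have "2 * l * (\<Sum>i\<in>{1..n}. card (T i + C i)) \<le> card (X + E) + real (card S)" by simp
  moreover have "real (card S) \<le> n * c * card (p ` X)" using cardS by (metis of_nat_le_iff)
  ultimately show ?thesis using that[OF EX cardE] by (simp add: algebra_simps)
qed

text \<open>For \<open>b\<close> and \<open>b'\<close> in the fibre over \<open>u\<close>, the point
  \<open>a + b - b'\<close> stays in the fibre of \<open>a\<close>. If that fibre is
  \<open>c\<close> times smaller, few \<open>b\<close> can bring \<open>a\<close> back into
  \<open>Y\<close>, which is the hypothesis of \<open>sparse_translates\<close>.\<close>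

lemma sparse_fibres_translates:
  fixes X :: "'a::euclidean_space set" and p :: "'a \<Rightarrow> 'a"
  assumes X: "finite X" and p: "linear p" and c: "c > 0" and B: "{a \<in> X. p a = u} \<noteq> {}"
  defines "Y \<equiv> {a \<in> X. c * card {b \<in> X. p b = p a} \<le> card {b \<in> X. p b = u}}"
  obtains C where "C \<subseteq> X" "card C \<le> c" "real c / 2 * card Y \<le> card (X + C)"
proof -
  define B where "B = {a \<in> X. p a = u}"
  have B: "finite B" "B \<noteq> {}" "B \<subseteq> X" using X B by (auto simp: B_def)
  have Y: "finite Y" "Y \<subseteq> X" using X by (auto simp: Y_def)
  have "real c * card {b \<in> B. a + b - b' \<in> Y} \<le> card B" if a: "a \<in> Y" "b' \<in> B" for a b'
  proof -
    have "(\<lambda>b. a + b - b') ` {b \<in> B. a + b - b' \<in> Y} \<subseteq> {b \<in> X. p b = p a}"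
      using a(2) Y p by (auto simp: B_def linear_diff linear_add)
    moreover have "inj_on (\<lambda>b. a + b - b') {b \<in> B. a + b - b' \<in> Y}" by (auto simp: inj_on_def)
    ultimately have "card {b \<in> B. a + b - b' \<in> Y} \<le> card {b \<in> X. p b = p a}"
      using X by (intro card_inj_on_le) auto
    then have "c * card {b \<in> B. a + b - b' \<in> Y} \<le> c * card {b \<in> X. p b = p a}" by simp
    also have "\<dots> \<le> card B" using a(1) by (simp add: Y_def B_def)
    finally show ?thesis by (metis of_nat_le_iff of_nat_mult)
  qed
  from sparse_translates[OF Y(1) B(1,2) c this] obtain C
    where C: "C \<subseteq> B" "card C \<le> c" "real c / 2 * card Y \<le> card (Y + C)" by blast
  have "card (Y + C) \<le> card (X + C)"
    using C(1) B X Y by (intro card_mono finite_set_plus set_plus_mono2) (auto intro: finite_subset)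
  then have "real c / 2 * card Y \<le> card (X + C)" using C(3) by linarith
  with that C B show ?thesis by blast
qed

section \<open>Projection along a vector, and nondegeneracy\<close>

definition proj :: "'a::real_inner \<Rightarrow> 'a \<Rightarrow> 'a" where
  "proj x v = v - (v \<bullet> x / (x \<bullet> x)) *\<^sub>R x"

lemma linear_proj: "linear (proj x)"
  by (rule linearI) (simp_all add: proj_def inner_add_left add_divide_distrib algebra_simps)

lemma proj_self: "x \<noteq> 0 \<Longrightarrow> proj x x = 0"
  by (simp add: proj_def)

text \<open>Composition with the projection adds at most the direction \<open>x\<close> to the
  kernel. This is the source of the step from \<open>Suc h\<close> to \<open>h\<close>.\<close>

lemma dim_kernel_proj:
  fixes q :: "'a::euclidean_space \<Rightarrow> 'a"
  shows "dim {v. q (proj x v) = 0} \<le> dim {v. q v = 0} + 1"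
proof -
  have "{v. q (proj x v) = 0} \<subseteq> span (insert x {v. q v = 0})"
  proof
    fix v assume "v \<in> {v. q (proj x v) = 0}"
    then have "proj x v \<in> span (insert x {v. q v = 0})" by (simp add: span_base)
    moreover have "(v \<bullet> x / (x \<bullet> x)) *\<^sub>R x \<in> span (insert x {v. q v = 0})"
      by (intro span_scale span_base) simp
    ultimately have "proj x v + (v \<bullet> x / (x \<bullet> x)) *\<^sub>R x \<in> span (insert x {v. q v = 0})"
      by (rule span_add)
    then show "v \<in> span (insert x {v. q v = 0})" by (simp add: proj_def)
  qed
  then have "dim {v. q (proj x v) = 0} \<le> dim (insert x {v. q v = 0})" by (rule dim_subset[of _ "span _", unfolded dim_span])
  also have "\<dots> \<le> dim {v. q v = 0} + 1" by (simp add: dim_insert)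
  finally show ?thesis .
qed

text \<open>Subspaces are encoded as kernels of linear maps and their translates as fibres. For
  \<open>h = 0\<close> the condition is empty; for \<open>h \<ge> 1\<close> and
  \<open>\<eta> > 0\<close> the identity map shows that a nonempty \<open>X\<close> has at least
  \<open>1 / \<eta>\<close> elements.\<close>

definition nondegenerate :: "nat \<Rightarrow> real \<Rightarrow> 'a::euclidean_space set \<Rightarrow> bool" where
  "nondegenerate h \<eta> X \<longleftrightarrow> (\<forall>q :: 'a \<Rightarrow> 'a. linear q \<longrightarrow> dim {v. q v = 0} < h \<longrightarrow>
     (\<forall>y. real (card {a \<in> X. q a = y}) \<le> \<eta> * real (card X)))"

text \<open>The summands come from \<open>X\<close> itself, as the hypothesis on \<open>A\<close>
  speaks only of sums with its own elements.\<close>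

definition expands :: "nat \<Rightarrow> real \<Rightarrow> 'a::ab_group_add set \<Rightarrow> bool" where
  "expands c K X \<longleftrightarrow> (\<exists>C\<subseteq>X. card C \<le> c \<and> K * real (card X) \<le> real (card (X + C)))"

text \<open>Each point of \<open>T\<close> carries at least \<open>l\<close> points of
  \<open>X\<close>. A subspace of dimension less than \<open>h\<close> with too many points of
  \<open>T\<close> would therefore pull back to one of dimension less than \<open>Suc h\<close> with
  too many points of \<open>X\<close>.\<close>

lemma nondegenerate_level:
  fixes X :: "'a::euclidean_space set" and l \<theta> \<eta>' :: real
  assumes X: "finite X" and nd: "nondegenerate (Suc h) \<eta> X"
    and T: "\<And>t. t \<in> T \<Longrightarrow> l \<le> card {a \<in> X. proj x a = t}" "T \<subseteq> proj x ` X"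
    and l: "\<theta> * card X \<le> l * card T" "l > 0" "\<theta> > 0" and e: "\<eta> \<le> \<theta> * \<eta>'" "\<eta>' \<ge> 0"
  shows "nondegenerate h \<eta>' T"
  unfolding nondegenerate_def
proof (intro allI impI)
  fix q :: "'a \<Rightarrow> 'a" and y assume q: "linear q" "dim {v. q v = 0} < h"
  have finT: "finite T" using T(2) X finite_subset by blast
  have "linear (\<lambda>v. q (proj x v))" using linear_compose[OF linear_proj q(1)] by (simp add: comp_def)
  moreover have "dim {v. q (proj x v) = 0} < Suc h" using dim_kernel_proj[of q x] q(2) by simp
  ultimately have "card {a \<in> X. q (proj x a) = y} \<le> \<eta> * card X"
    using nd unfolding nondegenerate_def by blast
  also have "\<dots> \<le> \<eta>' * (\<theta> * card X)"
    using mult_right_mono[OF e(1), of "real (card X)"] by (simp add: mult_ac)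
  also have "\<dots> \<le> \<eta>' * (l * card T)" using l(1) e(2) by (intro mult_left_mono)
  finally have 1: "card {a \<in> X. q (proj x a) = y} \<le> l * (\<eta>' * card T)" by (simp add: mult_ac)
  have "l * card {t \<in> T. q t = y} \<le> (\<Sum>t\<in>{t \<in> T. q t = y}. real (card {a \<in> X. proj x a = t}))"
    using T(1) sum_bounded_below[of "{t \<in> T. q t = y}" l "\<lambda>t. real (card {a \<in> X. proj x a = t})"]
    by (simp add: mult.commute)
  also have "\<dots> = card (\<Union>t\<in>{t \<in> T. q t = y}. {a \<in> X. proj x a = t})"
    using X finT by (subst card_UN_disjoint) auto
  also have "\<dots> \<le> card {a \<in> X. q (proj x a) = y}"
    using X by (intro of_nat_mono card_mono) auto
  also note 1
  finally show "card {t \<in> T. q t = y} \<le> \<eta>' * card T"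
    using l(2) by simp
qed

section \<open>Slicing by fibre size\<close>

lemma count_levels:
  fixes l y :: real and n :: nat
  assumes "l > 0" "y \<ge> 0" "y \<le> n * l"
  shows "y - l \<le> l * card {i \<in> {1..n}. real i * l \<le> y}"
proof -
  define k where "k = nat \<lfloor>y / l\<rfloor>"
  have k: "real k \<le> y / l" "y / l \<le> k + 1" using assms by (auto simp: k_def) linarith
  have "real k * l \<le> y" using k(1) assms(1) by (simp add: pos_le_divide_eq)
  then have "real k * l \<le> real n * l" using assms(3) by linarith
  then have kn: "k \<le> n" using assms(1) by simp
  have "{1..k} \<subseteq> {i \<in> {1..n}. real i * l \<le> y}"
  proof
    fix i assume "i \<in> {1..k}"
    then have "real i \<le> y / l" "i \<in> {1..n}" using k kn by auto
    then show "i \<in> {i \<in> {1..n}. real i * l \<le> y}" using assms by (simp add: field_simps)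
  qed
  then have "k \<le> card {i \<in> {1..n}. real i * l \<le> y}" using card_mono[of "{i \<in> {1..n}. real i * l \<le> y}" "{1..k}"] by simp
  then have "y / l - 1 \<le> card {i \<in> {1..n}. real i * l \<le> y}" using k by linarith
  then show ?thesis using assms by (simp add: field_simps)
qed

text \<open>Two losses, each by a factor \<open>1 - e\<close>: the points on fibres smaller than
  \<open>l / e\<close> are dropped, and the sizes of the other fibres are rounded down to multiples
  of \<open>l\<close>.\<close>

lemma sum_levels_ge:
  fixes X :: "'a set" and p :: "'a \<Rightarrow> 'b" and e l :: real and n :: nat
  defines "w \<equiv> \<lambda>t. card {a \<in> X. p a = t}"
  assumes X: "finite X" and l: "l > 0" "\<And>t. w t \<le> n * l" and e: "0 \<le> e" "e \<le> 1"
    and Y: "card {a \<in> X. e * w (p a) < l} \<le> e * card X"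
  shows "(1 - e)\<^sup>2 * card X \<le> l * (\<Sum>i\<in>{1..n}. card {t \<in> p ` X. real i * l \<le> w t})"
proof -
  define B where "B = {t \<in> p ` X. l \<le> e * w t}"
  have finB: "finite B" using X by (simp add: B_def)
  have XY: "{a \<in> X. \<not> e * w (p a) < l} = (\<Union>t\<in>B. {a \<in> X. p a = t})"
    by (auto simp: B_def)
  have "card X = card {a \<in> X. e * w (p a) < l} + card {a \<in> X. \<not> e * w (p a) < l}"
    using X by (subst card_Un_disjoint[symmetric]) (auto intro!: arg_cong[where f=card])
  also have "card {a \<in> X. \<not> e * w (p a) < l} = (\<Sum>t\<in>B. w t)"
  proof -
    have "card (\<Union>t\<in>B. {a \<in> X. p a = t}) = (\<Sum>t\<in>B. w t)"
      unfolding w_def using X finB by (intro card_UN_disjoint) auto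
    then show ?thesis by (simp only: XY)
  qed
  finally have "(1 - e) * card X \<le> (\<Sum>t\<in>B. real (w t))" using Y by (simp add: algebra_simps)
  then have "(1 - e) * ((1 - e) * card X) \<le> (1 - e) * (\<Sum>t\<in>B. real (w t))"
    using e by (intro mult_left_mono) auto
  also have "\<dots> = (\<Sum>t\<in>B. (1 - e) * w t)" by (rule sum_distrib_left)
  also have "\<dots> \<le> (\<Sum>t\<in>B. l * card {i \<in> {1..n}. real i * l \<le> w t})"
  proof (rule sum_mono)
    fix t assume "t \<in> B"
    then have "(1 - e) * w t \<le> w t - l" by (simp add: B_def algebra_simps)
    also have "\<dots> \<le> l * card {i \<in> {1..n}. real i * l \<le> w t}" using l by (intro count_levels) auto
    finally show "(1 - e) * w t \<le> l * card {i \<in> {1..n}. real i * l \<le> w t}" .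
  qed
  also have "\<dots> \<le> (\<Sum>t\<in>p ` X. l * card {i \<in> {1..n}. real i * l \<le> w t})"
    using X l by (intro sum_mono2) (auto simp: B_def)
  also have "\<dots> = l * (\<Sum>t\<in>p ` X. card {i \<in> {1..n}. real i * l \<le> w t})"
    by (simp add: sum_distrib_left)
  also have "(\<Sum>t\<in>p ` X. card {i \<in> {1..n}. real i * l \<le> w t}) = (\<Sum>i\<in>{1..n}. card {t \<in> p ` X. real i * l \<le> w t})"
    using X by (intro sum_card_swap) auto
  finally show ?thesis by (simp add: power2_eq_square mult.assoc)
qed

lemma expands_mono: "expands c K X \<Longrightarrow> c \<le> c' \<Longrightarrow> K' \<le> K \<Longrightarrow> expands c' K' X"
  unfolding expands_def by (meson mult_right_mono of_nat_0_le_iff order_trans)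

text \<open>Either some bounded sumset is already large, or \<open>X\<close> meets few lines in some
  direction. In the latter case, many points on lines much poorer than the richest one give a large
  sumset by \<open>sparse_fibres_translates\<close>. Otherwise the line sizes are comparable: each
  level expands by almost \<open>2 ^ h\<close>, and the fibres over a sum contribute the factor
  2.\<close>

lemma expansion_step:
  fixes \<epsilon> :: real
  assumes IH: "\<And>e :: real. e > 0 \<Longrightarrow> \<exists>\<eta>>0. \<exists>c. \<forall>X :: 'a::euclidean_space set. finite X \<longrightarrow> X \<noteq> {} \<longrightarrow>
      nondegenerate h \<eta> X \<longrightarrow> expands c (2 ^ h - e) X"
    and eps: "\<epsilon> > 0"
  shows "\<exists>\<eta>>0. \<exists>c. \<forall>X :: 'a set. finite X \<longrightarrow> X \<noteq> {} \<longrightarrow>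
      nondegenerate (Suc h) \<eta> X \<longrightarrow> expands c (2 ^ Suc h - \<epsilon>) X"
proof -
  define a :: real where "a = 2 ^ h"
  define K where "K = 2 * a"
  have a1: "a \<ge> 1" by (simp add: a_def)
  have K1: "K \<ge> 1" using a1 by (simp add: K_def)
  \<comment> \<open>The final factor is \<open>2 * ((a - e) * (1 - 3 * e)) - e\<close>, which equals
    \<open>K - e * (3 + 3 * K)\<close> plus a nonnegative quadratic term.\<close>
  define e where "e = min (1 / 8) (\<epsilon> / (3 + 3 * K))"
  have "e > 0" using eps K1 by (simp add: e_def)
  moreover have "e \<le> 1 / 8" unfolding e_def by (rule min.cobounded1)
  ultimately have e: "e > 0" "e \<le> 1 / 8" by blast+
  have "e \<le> \<epsilon> / (3 + 3 * K)" by (simp add: e_def)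
  then have e3: "e * (3 + 3 * K) \<le> \<epsilon>" using K1 by (simp add: pos_le_divide_eq)
  obtain \<eta>h ch where IH': "\<eta>h > 0" "\<And>X :: 'a set. finite X \<Longrightarrow> X \<noteq> {} \<Longrightarrow> nondegenerate h \<eta>h X \<Longrightarrow> expands ch (a - e) X"
    using IH[OF e(1)] unfolding a_def by blast
  \<comment> \<open>The \<open>+ 1\<close> keeps the divisor of \<open>\<epsilon>1\<close> positive
    even if \<open>ch = 0\<close>.\<close>
  define c1 where "c1 = ch + 1"
  have c1: "c1 > 0" by (simp add: c1_def)
  \<comment> \<open>\<open>c2\<close> is such that more than \<open>e * N\<close> points on poor
    fibres yield \<open>K * N\<close> sums. The richest fibre will be cut into \<open>n\<close>
    levels, so fine that a fibre larger than a \<open>c2\<close>-th of it has more than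
    \<open>1 / e\<close> times the height of a level.\<close>
  define c2 where "c2 = nat \<lceil>2 * K / e\<rceil> + 1"
  define n where "n = nat \<lceil>c2 / e\<rceil> + 1"
  have c2: "c2 > 0" "2 * K / e \<le> c2" and n: "n > 0" "c2 / e \<le> n"
    unfolding c2_def n_def by (simp_all, linarith+)
  \<comment> \<open>Makes the error of \<open>sumset_from_levels\<close>, which is
    \<open>n * c1\<close> times the number of lines, at most \<open>e * N\<close>.\<close>
  define \<epsilon>1 where "\<epsilon>1 = e / (n * c1)"
  have e1: "\<epsilon>1 > 0" using e n c1 by (simp add: \<epsilon>1_def)
  obtain c3 where c3: "c3 \<ge> 1" "\<And>A :: 'a set. finite A \<Longrightarrow> card A \<ge> c3 \<Longrightarrow>
    (\<forall>C\<subseteq>A. C \<noteq> {} \<longrightarrow> card C \<le> c3 \<longrightarrow> card (A + C) \<le> K * card A) \<Longrightarrow>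
    (\<exists>x. x \<noteq> 0 \<and> (\<forall>f :: 'a \<Rightarrow> 'a. linear f \<longrightarrow> f x = 0 \<longrightarrow> card (f ` A) \<le> \<epsilon>1 * card A))"
    using direction_with_few_lines[OF K1 e1] by blast
  \<comment> \<open>Levels of weight below \<open>\<theta> * N\<close> are given up; the
    \<open>n\<close> levels together lose at most \<open>e * N\<close> by this.\<close>
  define \<theta> where "\<theta> = e / n"
  have th: "\<theta> > 0" using e n by (simp add: \<theta>_def)
  \<comment> \<open>The first term forces \<open>card X \<ge> c3\<close>, as is seen from the
    identity map; the second passes nondegeneracy on to the heavy levels.\<close>
  define \<eta> where "\<eta> = min (1 / c3) (\<theta> * \<eta>h)"
  have eta: "\<eta> > 0" using c3 th IH' by (simp add: \<eta>_def)
  define c where "c = c2 + c3 + 3 * (n * c1)"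
  have main: "expands c (K - \<epsilon>) X" if X: "finite X" "X \<noteq> {}" and nd: "nondegenerate (Suc h) \<eta> X" for X :: "'a set"
  proof (cases "\<forall>C\<subseteq>X. C \<noteq> {} \<longrightarrow> card C \<le> c3 \<longrightarrow> card (X + C) \<le> K * card X")
    case False
    then have "expands c3 K X" unfolding expands_def by (meson linear)
    then show ?thesis by (rule expands_mono) (use eps in \<open>auto simp: c_def\<close>)
  next
    case small: True
    define N where "N = real (card X)"
    have N0: "N > 0" using X by (simp add: N_def card_gt_0_iff)
    have "card X \<ge> c3"
    proof -
      obtain y where "y \<in> X" using X by blast
      then have "{a \<in> X. a = y} = {y}" by auto
      moreover have "card {a \<in> X. a = y} \<le> \<eta> * N"
        using nd[unfolded nondegenerate_def, rule_format, of "\<lambda>v. v" y] by (simp add: linear_ident N_def)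
      ultimately have "1 \<le> \<eta> * N" by simp
      also have "\<dots> \<le> 1 / c3 * N" using N0 by (intro mult_right_mono) (auto simp: \<eta>_def)
      finally show ?thesis using c3(1) by (simp add: N_def field_simps)
    qed
    from c3(2)[OF X(1) this small] obtain x where x: "x \<noteq> 0"
      "\<And>f :: 'a \<Rightarrow> 'a. linear f \<Longrightarrow> f x = 0 \<Longrightarrow> card (f ` X) \<le> \<epsilon>1 * card X" by blast
    define p where "p = proj x"
    have p: "linear p" by (simp add: p_def linear_proj)
    have lines: "card (p ` X) \<le> \<epsilon>1 * N" using x(2)[OF p] proj_self[OF x(1)] by (simp add: p_def N_def)
    define w where "w t = card {a \<in> X. p a = t}" for t
    obtain u where u: "u \<in> p ` X" "\<And>t. t \<in> p ` X \<Longrightarrow> w t \<le> w u"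
      using finite_has_maximizer[of "p ` X" "\<lambda>t. real (w t)"] X by auto
    have w0: "w t = 0" if "t \<notin> p ` X" for t
    proof -
      have "{a \<in> X. p a = t} = {}" using that by auto
      then show ?thesis unfolding w_def by (simp only: card.empty)
    qed
    have wu: "w t \<le> w u" for t using u(2) w0[of t] by (cases "t \<in> p ` X") auto
    have une: "{a \<in> X. p a = u} \<noteq> {}" using u by auto
    then have M0: "w u > 0" using X by (simp add: w_def card_gt_0_iff)
    define Y where "Y = {a \<in> X. c2 * w (p a) \<le> w u}"
    obtain C where C: "C \<subseteq> X" "card C \<le> c2" "real c2 / 2 * card Y \<le> card (X + C)"
      using sparse_fibres_translates[OF X(1) p c2(1) une] unfolding Y_def w_def by blast
    show ?thesis
    proof (cases "card Y \<le> e * N")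
      case False
      have "K * N \<le> c2 / 2 * (e * N)" using c2(2) e N0 by (simp add: field_simps)
      also have "\<dots> \<le> c2 / 2 * card Y" using False by (intro mult_left_mono) auto
      also note C(3)
      finally have "expands c2 K X" using C(1,2) unfolding expands_def N_def by blast
      then show ?thesis by (rule expands_mono) (use eps in \<open>auto simp: c_def\<close>)
    next
      case True
      define l where "l = real (w u) / n"
      have l0: "l > 0" using M0 n by (simp add: l_def)
      have nl: "w t \<le> n * l" for t using wu[of t] n by (simp add: l_def)
      have "{a \<in> X. e * w (p a) < l} \<subseteq> Y"
      proof
        fix b assume b: "b \<in> {a \<in> X. e * w (p a) < l}"
        have "e * w (p b) < l" using b by simp
        also have "l \<le> w u / (c2 / e)" unfolding l_def using n c2 e by (intro divide_left_mono) auto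
        also have "\<dots> = e * (w u / c2)" by simp
        finally have "w (p b) < w u / c2" by (simp only: mult_less_cancel_left_pos[OF e(1)])
        then have "real c2 * w (p b) < w u" using c2(1) by (simp add: field_simps)
        then have "c2 * w (p b) < w u" by (metis of_nat_less_iff of_nat_mult)
        then show "b \<in> Y" using b by (simp add: Y_def)
      qed
      then have "card {a \<in> X. e * w (p a) < l} \<le> card Y" using X by (intro card_mono) (auto simp: Y_def)
      then have "card {a \<in> X. e * w (p a) < l} \<le> e * N" using True by linarith
      then have lev: "(1 - e)\<^sup>2 * N \<le> l * (\<Sum>i\<in>{1..n}. card {t \<in> p ` X. real i * l \<le> w t})"
        using sum_levels_ge[of X l p n e] X l0 nl e unfolding w_def N_def by simp
      define L where "L i = {t \<in> p ` X. real i * l \<le> w t}" for i :: nat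
      \<comment> \<open>Subtracting \<open>\<theta> * N\<close> makes the claim uniform: for a light
        level the left side is not positive, and the empty set of summands will do.\<close>
      have "\<exists>C\<subseteq>L i. card C \<le> c1 \<and> (a - e) * (l * card (L i) - \<theta> * N) \<le> l * card (L i + C)"
        if i: "i \<in> {1..n}" for i
      proof (cases "\<theta> * N \<le> l * card (L i)")
        case False
        then have "(a - e) * (l * card (L i) - \<theta> * N) \<le> 0" using a1 e by (intro mult_nonneg_nonpos) auto
        also have "\<dots> \<le> l * card (L i + {})" using l0 by simp
        finally show ?thesis by (intro exI[of _ "{}"]) simp
      next
        case True
        have "l * card (L i) \<le> (real i * l) * card (L i)" using i l0 by (intro mult_right_mono) auto
        then have T: "\<theta> * card X \<le> (real i * l) * card (L i)" using True by (simp add: N_def)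
        have "nondegenerate h \<eta>h (L i)"
        proof (rule nondegenerate_level[OF X(1) nd, of _ "real i * l" x \<theta>])
          show "L i \<subseteq> proj x ` X" by (auto simp: L_def p_def)
          show "real i * l \<le> card {a \<in> X. proj x a = t}" if "t \<in> L i" for t
            using that by (simp add: L_def w_def p_def)
        qed (use T i l0 th IH' in \<open>auto simp: \<eta>_def\<close>)
        moreover have "0 < l * card (L i)" using True th N0 by (meson less_le_trans mult_pos_pos)
        then have "card (L i) \<noteq> 0" by (intro notI) simp
        then have "finite (L i)" "L i \<noteq> {}" by (auto intro: card_ge_0_finite)
        ultimately have "expands ch (a - e) (L i)" using IH'(2) by blast
        then obtain C where C: "C \<subseteq> L i" "card C \<le> ch" "(a - e) * card (L i) \<le> card (L i + C)"
          unfolding expands_def by blast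
        have "(a - e) * (l * card (L i) - \<theta> * N) \<le> (a - e) * (l * card (L i))"
          using a1 e th N0 by (intro mult_left_mono) auto
        also have "\<dots> = l * ((a - e) * card (L i))" by simp
        also have "\<dots> \<le> l * card (L i + C)" using C l0 by (intro mult_left_mono) auto
        finally show ?thesis using C by (intro exI[of _ C]) (auto simp: c1_def)
      qed
      then obtain F where F: "\<And>i. i \<in> {1..n} \<Longrightarrow> F i \<subseteq> L i \<and> card (F i) \<le> c1"
        "\<And>i. i \<in> {1..n} \<Longrightarrow> (a - e) * (l * card (L i) - \<theta> * N) \<le> l * card (L i + F i)" by metis
      obtain D where D: "D \<subseteq> X" "card D \<le> 3 * (n * c1)"
        "2 * l * (\<Sum>i\<in>{1..n}. card (L i + F i)) - n * c1 * card (p ` X) \<le> card (X + D)"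
        using sumset_from_levels[OF X(1) p, of l n F c1] F(1) l0 unfolding L_def w_def by auto
      have "(a - e) * ((1 - e)\<^sup>2 * N - e * N) \<le> (a - e) * (l * (\<Sum>i\<in>{1..n}. card (L i)) - e * N)"
        using lev a1 e by (intro mult_left_mono) (auto simp: L_def)
      also have "\<dots> = (\<Sum>i\<in>{1..n}. (a - e) * (l * card (L i) - \<theta> * N))"
        using n by (simp add: sum_distrib_left[symmetric] sum_subtractf \<theta>_def)
      also have "\<dots> \<le> (\<Sum>i\<in>{1..n}. l * card (L i + F i))" by (intro sum_mono F(2))
      also have "\<dots> = l * (\<Sum>i\<in>{1..n}. card (L i + F i))" by (simp add: sum_distrib_left)
      finally have 1: "(a - e) * ((1 - e)\<^sup>2 * N - e * N) \<le> l * (\<Sum>i\<in>{1..n}. card (L i + F i))" .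
      have "n * c1 * card (p ` X) \<le> (real n * c1) * (\<epsilon>1 * N)"
        using lines by (simp add: mult_left_mono)
      also have "\<dots> = e * N" using n c1 by (simp add: \<epsilon>1_def)
      finally have "2 * ((a - e) * ((1 - e)\<^sup>2 * N - e * N)) - e * N \<le> card (X + D)"
        using D(3) 1 by linarith
      moreover have "(K - \<epsilon>) * N \<le> 2 * ((a - e) * ((1 - e)\<^sup>2 * N - e * N)) - e * N"
      proof -
        have "(a - e) * (1 - 3 * e) \<le> (a - e) * ((1 - e)\<^sup>2 - e)"
          using a1 e by (intro mult_left_mono) (auto simp: power2_eq_square algebra_simps)
        moreover have "K - \<epsilon> \<le> 2 * ((a - e) * (1 - 3 * e)) - e"
        proof -
          have "2 * ((a - e) * (1 - 3 * e)) - e = K - e * (3 + 3 * K) + e * (e * 6)"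
            by (simp add: K_def algebra_simps)
          moreover have "0 \<le> e * (e * 6)" using e by simp
          ultimately show ?thesis using e3 by linarith
        qed
        ultimately have "K - \<epsilon> \<le> 2 * ((a - e) * ((1 - e)\<^sup>2 - e)) - e" by linarith
        then have "(K - \<epsilon>) * N \<le> (2 * ((a - e) * ((1 - e)\<^sup>2 - e)) - e) * N"
          using N0 by (intro mult_right_mono) auto
        then show ?thesis by (simp add: algebra_simps)
      qed
      ultimately have "(K - \<epsilon>) * card X \<le> card (X + D)" by (simp add: N_def)
      then have "expands (3 * (n * c1)) (K - \<epsilon>) X" using D unfolding expands_def by blast
      then show ?thesis by (rule expands_mono) (auto simp: c_def)
    qed
  qed
  then show ?thesis using eta by (auto simp: K_def a_def)
qed

lemma nondegenerate_expands:
  fixes \<epsilon> :: real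
  shows "\<epsilon> > 0 \<Longrightarrow> \<exists>\<eta>>0. \<exists>c. \<forall>X :: 'a::euclidean_space set. finite X \<longrightarrow> X \<noteq> {} \<longrightarrow>
      nondegenerate h \<eta> X \<longrightarrow> expands c (2 ^ h - \<epsilon>) X"
proof (induction h arbitrary: \<epsilon>)
  case 0
  have "expands 1 (2 ^ 0 - \<epsilon>) X" if X: "X \<noteq> {}" for X :: "'a set"
  proof -
    obtain b where "b \<in> X" using X by blast
    moreover have "(2 ^ 0 - \<epsilon>) * real (card X) \<le> 1 * real (card X)"
      using 0 by (intro mult_right_mono) auto
    ultimately show ?thesis unfolding expands_def by (intro exI[of _ "{b}"]) (auto simp: card_translate)
  qed
  then show ?case by (intro exI[of _ "1::real"] exI[of _ "1::nat"] conjI allI impI) auto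
next
  case (Suc h)
  then show ?case by (intro expansion_step)
qed

section \<open>Weighted sums and Freiman's lemma\<close>

text \<open>The points of \<open>S\<close> visible from \<open>v\<close> span the cone over \<open>S\<close> with apex \<open>v\<close>: the first point \<open>q\<close> of
  the hull on a ray from \<open>v\<close> is a convex combination of visible points only, since an invisible one
  could be traded for a point closer to \<open>v\<close>.\<close>

lemma affine_hull_visible:
  fixes S :: "'a::euclidean_space set"
  assumes S: "finite S" and v: "v \<notin> convex hull S"
  shows "S \<subseteq> affine hull (insert v {u \<in> S. (1/2) *\<^sub>R (v + u) \<notin> convex hull S})"
proof
  fix t assume t: "t \<in> S"
  define U where "U = {u \<in> S. (1/2) *\<^sub>R (v + u) \<notin> convex hull S}"
  define I where "I = {s \<in> {0..1::real}. v + s *\<^sub>R (t - v) \<in> convex hull S}"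
  have "compact (convex hull S)" using S by (rule finite_imp_compact_convex_hull)
  then have "closed ((\<lambda>s. v + s *\<^sub>R (t - v)) -` (convex hull S))"
    by (intro closed_vimage compact_imp_closed continuous_intros)
  then have "compact ({0..1} \<inter> ((\<lambda>s. v + s *\<^sub>R (t - v)) -` (convex hull S)))"
    by (intro compact_Int_closed) auto
  then have "compact I" by (simp add: I_def Int_def vimage_def)
  moreover have "1 \<in> I" using t by (simp add: I_def hull_inc)
  ultimately obtain s where s: "s \<in> I" "\<And>r. r \<in> I \<Longrightarrow> s \<le> r"
    using continuous_attains_inf[of I "\<lambda>x. x"] by auto
  have "s \<noteq> 0" using s(1) v by (auto simp: I_def)
  then have s0: "0 < s" "s \<le> 1" using s(1) by (auto simp: I_def)
  define q where "q = v + s *\<^sub>R (t - v)"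
  have "q \<in> convex hull S" using s(1) by (simp add: I_def q_def)
  then obtain c where c: "\<And>x. x \<in> S \<Longrightarrow> 0 \<le> c x" "sum c S = 1" "(\<Sum>x\<in>S. c x *\<^sub>R x) = q"
    using S by (auto simp: convex_hull_finite)
  have vis: "x \<in> U" if x: "x \<in> S" "c x > 0" for x
  proof (rule ccontr)
    assume "x \<notin> U"
    then have "(1/2) *\<^sub>R (v + x) \<in> convex hull S" using x by (simp add: U_def)
    then obtain d where d: "\<And>x. x \<in> S \<Longrightarrow> 0 \<le> d x" "sum d S = 1" "(\<Sum>x\<in>S. d x *\<^sub>R x) = (1/2) *\<^sub>R (v + x)"
      using S by (auto simp: convex_hull_finite)
    \<comment> \<open>If the midpoint of \<open>v\<close> and \<open>x\<close> lies in the hull, its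
      combination \<open>d\<close> may replace \<open>x\<close>, which is twice the midpoint minus
      \<open>v\<close>. Renormalising by \<open>1 + c x\<close> gives a point of the same ray with
      parameter \<open>s / (1 + c x)\<close>, contradicting the choice of \<open>s\<close>.\<close>
    define e where "e y = ((if y = x then 0 else c y) + 2 * c x * d y) / (1 + c x)" for y
    have c': "(if y = x then 0 else c y) = c y - (if y = x then c y else 0)" for y by simp
    have e0: "0 \<le> e y" if "y \<in> S" for y
      using c(1)[OF that] d(1)[OF that] x(2) by (simp add: e_def)
    have "sum e S = ((\<Sum>y\<in>S. if y = x then 0 else c y) + 2 * c x * sum d S) / (1 + c x)"
      by (simp add: e_def sum.distrib sum_distrib_left flip: sum_divide_distrib)
    also have "(\<Sum>y\<in>S. if y = x then 0 else c y) = 1 - c x"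
      unfolding c' sum_subtractf using c x S by simp
    finally have e1: "sum e S = 1" using d x by simp
    have "(\<Sum>y\<in>S. e y *\<^sub>R y) = (1 / (1 + c x)) *\<^sub>R ((\<Sum>y\<in>S. (if y = x then 0 else c y) *\<^sub>R y) + (2 * c x) *\<^sub>R (\<Sum>y\<in>S. d y *\<^sub>R y))"
      by (simp add: e_def scaleR_sum_right scaleR_add_left add_divide_distrib scaleR_right_distrib sum.distrib)
    also have "(\<Sum>y\<in>S. (if y = x then 0 else c y) *\<^sub>R y) = (\<Sum>y\<in>S. c y *\<^sub>R y) - (\<Sum>y\<in>S. if y = x then c y *\<^sub>R y else 0)"
      unfolding c' sum_subtractf[symmetric] by (intro sum.cong) (auto simp: algebra_simps)
    also have "\<dots> = q - c x *\<^sub>R x" using c x S by simp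
    also have "(1 / (1 + c x)) *\<^sub>R (q - c x *\<^sub>R x + (2 * c x) *\<^sub>R (\<Sum>y\<in>S. d y *\<^sub>R y)) = (1 / (1 + c x)) *\<^sub>R (q + c x *\<^sub>R v)"
      by (simp add: d algebra_simps)
    also have "q + c x *\<^sub>R v = (1 + c x) *\<^sub>R v + s *\<^sub>R (t - v)"
      by (simp add: q_def algebra_simps)
    also have "(1 / (1 + c x)) *\<^sub>R \<dots> = v + (s / (1 + c x)) *\<^sub>R (t - v)"
      using x by (simp add: scaleR_right_distrib)
    finally have "v + (s / (1 + c x)) *\<^sub>R (t - v) \<in> convex hull S"
      using e0 e1 S by (auto simp: convex_hull_finite)
    moreover have less: "s / (1 + c x) < s" using s0 x by (simp add: field_simps)
    moreover have "0 \<le> s / (1 + c x)" using s0 x by simp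
    ultimately have "s / (1 + c x) \<in> I" using s0 by (simp add: I_def)
    from s(2)[OF this] less show False by simp
  qed
  have "q = (\<Sum>x\<in>U. c x *\<^sub>R x)" "sum c U = 1"
  proof -
    have US: "U \<subseteq> S" by (auto simp: U_def)
    have 0: "\<forall>x\<in>S - U. c x = 0"
    proof
      fix x assume "x \<in> S - U"
      then show "c x = 0" using vis[of x] c(1)[of x] by force
    qed
    show "sum c U = 1" using sum.mono_neutral_right[OF S US 0] c(2) by simp
    have "\<forall>x\<in>S - U. c x *\<^sub>R x = 0" using 0 by simp
    from sum.mono_neutral_right[OF S US this] show "q = (\<Sum>x\<in>U. c x *\<^sub>R x)" using c(3) by simp
  qed
  then have "q \<in> convex hull U"
    using c(1) S by (auto simp: U_def convex_hull_finite)
  then have "q \<in> affine hull U" using convex_hull_subset_affine_hull by blast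
  then have "q \<in> affine hull (insert v U)" by (meson hull_mono subsetD subset_insertI)
  moreover have "v \<in> affine hull (insert v U)" by (simp add: hull_inc)
  ultimately have "(1 / s) *\<^sub>R q + (1 - 1 / s) *\<^sub>R v \<in> affine hull (insert v U)"
    by (intro mem_affine) auto
  moreover have "(1 / s) *\<^sub>R q + (1 - 1 / s) *\<^sub>R v = t"
    using s0 by (simp add: q_def algebra_simps)
  ultimately show "t \<in> affine hull (insert v {u \<in> S. (1/2) *\<^sub>R (v + u) \<notin> convex hull S})"
    by (simp add: U_def)
qed

text \<open>Freiman's lemma in a weighted form: \<open>R\<close> is a graph on \<open>T\<close> in which every vertex has degree at least
  the affine dimension. It grows by joining an extreme point of \<open>T\<close> to the points visible from it.\<close>

lemma distinct_sums_graph: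
  fixes T :: "'a::euclidean_space set"
  assumes "finite T" "T \<noteq> {}"
  shows "\<exists>R \<subseteq> T \<times> T. inj_on (\<lambda>r. fst r + snd r) R \<and> (\<forall>r\<in>R. \<forall>t\<in>T. fst r + snd r \<noteq> t + t) \<and>
    (\<forall>w :: 'a \<Rightarrow> real. (\<forall>t\<in>T. 0 \<le> w t) \<longrightarrow> aff_dim T * sum w T \<le> (\<Sum>r\<in>R. w (fst r) + w (snd r))) \<and>
    aff_dim T * real (card T) - aff_dim T * (aff_dim T + 1) / 2 \<le> card R"
  using assms
proof (induction "card T" arbitrary: T)
  case 0
  then show ?case by simp
next
  case (Suc n)
  show ?case
  proof (cases "n = 0")
    case True
    then obtain t where "T = {t}" using Suc by (metis One_nat_def card_1_singletonE)
    then show ?thesis by (intro exI[of _ "{}"]) auto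
  next
    case False
    have "convex hull T \<noteq> {}" "compact (convex hull T)"
      using Suc.prems by (auto intro: finite_imp_compact_convex_hull)
    then obtain v where v: "v extreme_point_of (convex hull T)"
      using extreme_point_exists_convex by blast
    define S where "S = T - {v}"
    have vT: "v \<in> T" using v extreme_point_of_convex_hull by blast
    have TS: "T = insert v S" "v \<notin> S" using vT by (auto simp: S_def)
    have "card S = n" using Suc.hyps(2) Suc.prems vT by (simp add: S_def)
    then have S: "finite S" "S \<noteq> {}" "card S = n"
      using Suc.prems(1) False by (simp add: S_def, metis card.empty, simp)
    have vS: "v \<notin> convex hull S"
    proof -
      have "convex (convex hull T - {v})"
        using v extreme_point_of_stillconvex[OF convex_convex_hull] by blast
      moreover have "S \<subseteq> convex hull T - {v}" by (auto simp: S_def hull_inc)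
      ultimately have "convex hull S \<subseteq> convex hull T - {v}" by (simp add: hull_minimal)
      then show ?thesis by blast
    qed
    obtain R where R: "R \<subseteq> S \<times> S" "inj_on (\<lambda>r. fst r + snd r) R"
      "\<forall>r\<in>R. \<forall>t\<in>S. fst r + snd r \<noteq> t + t"
      "\<forall>w :: 'a \<Rightarrow> real. (\<forall>t\<in>S. 0 \<le> w t) \<longrightarrow> aff_dim S * sum w S \<le> (\<Sum>r\<in>R. w (fst r) + w (snd r))"
      "aff_dim S * real (card S) - aff_dim S * (aff_dim S + 1) / 2 \<le> card R"
      using Suc.hyps(1)[OF S(3)[symmetric] S(1,2)] by (elim exE conjE) (rule that)
    \<comment> \<open>Midpoints of points of \<open>S\<close> lie in the hull of \<open>S\<close>,
      so for a point \<open>u\<close> visible from \<open>v\<close> the sum \<open>v + u\<close> is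
      new; this includes doubles.\<close>
    define U where "U = {u \<in> S. (1/2) *\<^sub>R (v + u) \<notin> convex hull S}"
    define N where "N = Pair v ` U"
    have mid: "(1/2) *\<^sub>R (a + b) \<in> convex hull S" if "a \<in> S" "b \<in> S" for a b
      using convexD[OF convex_convex_hull hull_inc[OF that(1)] hull_inc[OF that(2)], of "1/2" "1/2"]
      by (simp add: scaleR_right_distrib)
    have finU: "finite U" and finR: "finite R" and US: "U \<subseteq> S"
      using S R(1) finite_subset by (auto simp: U_def)
    have disj: "R \<inter> N = {}" using R(1) TS by (auto simp: N_def)
    have cardN: "card N = card U" by (simp add: N_def card_image inj_on_def)
    have new: "v + u \<noteq> a + b" if "u \<in> U" "a \<in> S" "b \<in> S" for u a b
      using that mid[of a b] by (auto simp: U_def)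
    have inj: "inj_on (\<lambda>r. fst r + snd r) (R \<union> N)"
    proof -
      have "inj_on (\<lambda>r. fst r + snd r) N" by (auto simp: N_def inj_on_def)
      moreover have "(\<lambda>r. fst r + snd r) ` (R - N) \<inter> (\<lambda>r. fst r + snd r) ` (N - R) = {}"
        using new R(1) by (fastforce simp: N_def)
      ultimately show ?thesis using R(2) by (simp add: inj_on_Un)
    qed
    have dbl: "fst r + snd r \<noteq> t + t" if r: "r \<in> R \<union> N" and t: "t \<in> T" for r t
    proof (cases "t = v")
      case tv: True
      show ?thesis
      proof (cases "r \<in> R")
        case True
        then have "(1/2) *\<^sub>R (fst r + snd r) \<in> convex hull S" using R(1) mid by auto
        moreover have "(1/2) *\<^sub>R (v + v) = v" by (simp flip: scaleR_2)
        ultimately show ?thesis using vS by (auto simp: tv)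
      next
        case False
        then obtain u where "u \<in> U" "r = (v, u)" using r by (auto simp: N_def)
        then show ?thesis using TS(2) US by (auto simp: tv)
      qed
    next
      case False
      then have tS: "t \<in> S" using t TS(1) by blast
      show ?thesis
      proof (cases "r \<in> R")
        case True
        then show ?thesis using R(3) tS by blast
      next
        case False
        then obtain u where "u \<in> U" "r = (v, u)" using r by (auto simp: N_def)
        then show ?thesis using new[OF _ tS tS] by simp
      qed
    qed
    have sum: "(\<Sum>r\<in>R \<union> N. w (fst r) + w (snd r)) = (\<Sum>r\<in>R. w (fst r) + w (snd r)) + (\<Sum>u\<in>U. w v + w u)"
      for w :: "'a \<Rightarrow> real"
      using finU finR disj by (subst sum.union_disjoint) (auto simp: N_def sum.reindex inj_on_def)
    have sumT: "sum w T = w v + sum w S" for w :: "'a \<Rightarrow> real" using TS S by simp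
    have cardT: "card T = n + 1" using TS S by simp
    have cardRN: "card (R \<union> N) = card R + card U"
      using finU finR disj cardN by (simp add: card_Un_disjoint N_def)
    \<comment> \<open>If \<open>v\<close> lies in the affine hull of \<open>S\<close>, then
      \<open>v\<close> and the visible points still span it, so there are at least
      \<open>aff_dim T\<close> new edges. Otherwise the dimension rises by one, but all of
      \<open>S\<close> is visible.\<close>
    have main: "(\<forall>w :: 'a \<Rightarrow> real. (\<forall>t\<in>T. 0 \<le> w t) \<longrightarrow> aff_dim T * sum w T \<le> (\<Sum>r\<in>R. w (fst r) + w (snd r)) + (\<Sum>u\<in>U. w v + w u)) \<and>
       aff_dim T * real (n + 1) - aff_dim T * (aff_dim T + 1) / 2 \<le> real (card R) + card U"
    proof (cases "v \<in> affine hull S")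
      case True
      then have dim: "aff_dim T = aff_dim S" using TS by (simp add: aff_dim_insert)
      have "aff_dim T \<le> aff_dim (insert v U)"
      proof -
        have "T \<subseteq> affine hull (insert v U)"
          using affine_hull_visible[OF S(1) vS] TS by (auto simp: U_def hull_inc)
        then show ?thesis by (metis aff_dim_affine_hull aff_dim_subset)
      qed
      moreover have "aff_dim (insert v U) \<le> int (card U)"
      proof -
        have "card (insert v U) = card U + 1" using finU US TS(2) by (subst card_insert_disjoint) auto
        then show ?thesis using aff_dim_le_card[of "insert v U"] finU by simp
      qed
      ultimately have "aff_dim T \<le> int (card U)" by simp
      then have dU: "aff_dim T \<le> real (card U)" by linarith
      have "aff_dim T * sum w T \<le> (\<Sum>r\<in>R. w (fst r) + w (snd r)) + (\<Sum>u\<in>U. w v + w u)"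
        if w: "\<forall>t\<in>T. 0 \<le> w t" for w :: "'a \<Rightarrow> real"
      proof -
        have "aff_dim T * sum w T = aff_dim S * sum w S + aff_dim T * w v"
          by (simp add: sumT dim algebra_simps)
        also have "aff_dim S * sum w S \<le> (\<Sum>r\<in>R. w (fst r) + w (snd r))" using w TS by (intro R(4)[rule_format]) auto
        also have "aff_dim T * w v \<le> card U * w v" using dU w TS by (intro mult_right_mono) auto
        also have "\<dots> \<le> (\<Sum>u\<in>U. w v + w u)" using w US TS by (auto simp: sum.distrib intro!: sum_nonneg)
        finally show ?thesis by simp
      qed
      moreover have "aff_dim T * real (n + 1) - aff_dim T * (aff_dim T + 1) / 2 \<le> real (card R) + card U"
        using R(5) dU dim S(3) by (simp add: algebra_simps)
      ultimately show ?thesis by blast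
    next
      case False
      then have dim: "aff_dim T = aff_dim S + 1" using TS by (simp add: aff_dim_insert)
      have "U = S"
      proof -
        have "v \<in> affine hull S" if "(1/2) *\<^sub>R (v + u) \<in> convex hull S" "u \<in> S" for u
        proof -
          have "(1/2) *\<^sub>R (v + u) \<in> affine hull S" using that convex_hull_subset_affine_hull by blast
          then have "2 *\<^sub>R ((1/2) *\<^sub>R (v + u)) + (-1) *\<^sub>R u \<in> affine hull S"
            using that by (intro mem_affine) (auto simp: hull_inc)
          then show ?thesis by simp
        qed
        then show ?thesis using False by (auto simp: U_def)
      qed
      have "aff_dim S + 1 \<le> n" using aff_dim_le_card[of S] S by auto
      then have dn: "aff_dim S + 1 \<le> real n" by linarith
      have "aff_dim T * sum w T \<le> (\<Sum>r\<in>R. w (fst r) + w (snd r)) + (\<Sum>u\<in>U. w v + w u)"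
        if w: "\<forall>t\<in>T. 0 \<le> w t" for w :: "'a \<Rightarrow> real"
      proof -
        have "aff_dim T * sum w T = aff_dim S * sum w S + sum w S + (aff_dim S + 1) * w v"
          by (simp add: sumT dim algebra_simps)
        also have "aff_dim S * sum w S \<le> (\<Sum>r\<in>R. w (fst r) + w (snd r))" using w TS by (intro R(4)[rule_format]) auto
        also have "(aff_dim S + 1) * w v \<le> n * w v" using dn w TS by (intro mult_right_mono) auto
        finally show ?thesis using \<open>U = S\<close> S by (simp add: sum.distrib)
      qed
      moreover have "aff_dim T * real (n + 1) - aff_dim T * (aff_dim T + 1) / 2 \<le> real (card R) + card U"
        using R(5) dim S(3) \<open>U = S\<close> by (simp add: field_simps)
      ultimately show ?thesis by blast
    qed
    show ?thesis
    proof (intro exI[of _ "R \<union> N"] conjI)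
      show "R \<union> N \<subseteq> T \<times> T" using R(1) US TS by (auto simp: N_def)
      show "\<forall>r\<in>R \<union> N. \<forall>t\<in>T. fst r + snd r \<noteq> t + t" using dbl by blast
      show "\<forall>w :: 'a \<Rightarrow> real. (\<forall>t\<in>T. 0 \<le> w t) \<longrightarrow>
          aff_dim T * sum w T \<le> (\<Sum>r\<in>R \<union> N. w (fst r) + w (snd r))"
        unfolding sum by (rule conjunct1[OF main])
      show "aff_dim T * real (card T) - aff_dim T * (aff_dim T + 1) / 2 \<le> card (R \<union> N)"
        unfolding cardT cardRN of_nat_add by (rule conjunct2[OF main[unfolded of_nat_add]])
    qed (rule inj)
  qed
qed

text \<open>The doubles \<open>t + t\<close> are \<open>card T\<close> sums besides those of the
  graph, which raises the factor from \<open>j\<close> to \<open>j + 1\<close>.\<close>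

lemma freiman_card_sums:
  fixes T :: "'a::euclidean_space set"
  assumes T: "finite T" "T \<noteq> {}" and j: "aff_dim T = int j" and R: "finite R"
    and cover: "\<And>a b. a \<in> T \<Longrightarrow> b \<in> T \<Longrightarrow> \<exists>r\<in>R. fst r + snd r = a + b"
  shows "(j + 1) * real (card T) - j * (j + 1) / 2 \<le> card R"
proof -
  define s where "s r = fst r + snd r" for r :: "'a \<times> 'a"
  obtain E where E: "E \<subseteq> T \<times> T" "inj_on s E" "\<forall>r\<in>E. \<forall>t\<in>T. s r \<noteq> t + t"
    "aff_dim T * real (card T) - aff_dim T * (aff_dim T + 1) / 2 \<le> card E"
    using distinct_sums_graph[OF T] unfolding s_def by blast
  have finE: "finite E" using E(1) T finite_subset by blast
  have "inj_on (\<lambda>t::'a. t + t) T" by (auto simp: inj_on_def simp flip: scaleR_2)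
  then have "card T + card E = card ((\<lambda>t. t + t) ` T) + card (s ` E)"
    using E(2) by (simp add: card_image)
  also have "\<dots> = card ((\<lambda>t. t + t) ` T \<union> s ` E)"
    using E(3) T finE by (intro card_Un_disjoint[symmetric]) (auto, metis)
  also have "\<dots> \<le> card (s ` R)"
  proof (rule card_mono)
    show "(\<lambda>t. t + t) ` T \<union> s ` E \<subseteq> s ` R"
    proof
      fix v assume "v \<in> (\<lambda>t. t + t) ` T \<union> s ` E"
      then obtain a b where "a \<in> T" "b \<in> T" "v = a + b" using E(1) by (auto simp: s_def)
      with cover[of a b] obtain r where "r \<in> R" "s r = v" by (auto simp: s_def)
      then show "v \<in> s ` R" by blast
    qed
  qed (use R in auto)
  also have "\<dots> \<le> card R" using R by (rule card_image_le)
  finally have "real (card T) + card E \<le> card R" by linarith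
  with E(4) show ?thesis by (simp add: j algebra_simps)
qed

text \<open>Points are added in order of decreasing weight \<open>w\<close>; \<open>p\<close> is the size of the largest affinely
  independent initial segment. A new point \<open>t\<close> outside the affine hull contributes the sums with all points,
  otherwise its new sums weigh at least \<open>2 * w t\<close> each and are counted by Freiman's lemma, the surplus
  over that lemma being carried along in the last term.\<close>

lemma weighted_sums_growth:
  fixes T :: "'a::euclidean_space set" and w :: "'a \<Rightarrow> real"
  assumes "finite T" "T \<noteq> {}" "\<forall>t\<in>T. 0 \<le> w t \<and> w t \<le> M"
  shows "\<exists>R \<subseteq> T \<times> T. \<exists>p j::nat. inj_on (\<lambda>r. fst r + snd r) R \<and>
    (\<forall>a\<in>T. \<forall>b\<in>T. \<exists>r\<in>R. fst r + snd r = a + b) \<and>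
    aff_dim T = int j \<and> 1 \<le> p \<and> p \<le> j + 1 \<and> (p = card T \<or> 2 \<le> p \<and> j + 2 \<le> card T) \<and>
    (\<forall>\<mu>\<ge>0. (\<forall>t\<in>T. \<mu> \<le> w t) \<longrightarrow>
      (real j + 2) * sum w T + Max {0, sum w T - p * M, (real p - 1) * (sum w T - (real j + 1) * M)}
        + 2 * \<mu> * (card R - ((real j + 1) * card T - real j * (real j + 1) / 2))
      \<le> (\<Sum>r\<in>R. w (fst r) + w (snd r)))"
  using assms
proof (induction "card T" arbitrary: T)
  case 0
  then show ?case by simp
next
  case (Suc n)
  show ?case
  proof (cases "n = 0")
    case True
    then obtain t where t: "T = {t}" using Suc by (metis One_nat_def card_1_singletonE)
    have "0 \<le> w t" "w t \<le> M" using Suc.prems t by auto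
    then show ?thesis unfolding t
      by (intro exI[of _ "{(t, t)}"] exI[of _ "1::nat"] exI[of _ "0::nat"]) auto
  next
    case False
    obtain t where t: "t \<in> T" "\<And>s. s \<in> T \<Longrightarrow> w t \<le> w s"
      using finite_has_maximizer[OF Suc.prems(1,2), of "\<lambda>s. - w s"] by auto
    define S where "S = T - {t}"
    have TS: "T = insert t S" "t \<notin> S" using t by (auto simp: S_def)
    have cS: "card S = n" using Suc.hyps(2) Suc.prems t by (simp add: S_def)
    then have S: "finite S" "S \<noteq> {}" using Suc.prems(1) False by (simp add: S_def, metis card.empty)
    have cT: "card T = n + 1" using Suc.hyps(2) by simp
    have wS: "\<forall>s\<in>S. 0 \<le> w s \<and> w s \<le> M" using Suc.prems(3) TS by blast
    have wt: "0 \<le> w t" "w t \<le> M" using Suc.prems(3) t by auto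
    obtain R p j where R: "R \<subseteq> S \<times> S" "inj_on (\<lambda>r. fst r + snd r) R"
      "\<forall>a\<in>S. \<forall>b\<in>S. \<exists>r\<in>R. fst r + snd r = a + b"
      and j: "aff_dim S = int j" and p: "1 \<le> p" "p \<le> j + 1" "p = card S \<or> 2 \<le> p \<and> j + 2 \<le> card S"
      and bound: "\<forall>\<mu>\<ge>0. (\<forall>t\<in>S. \<mu> \<le> w t) \<longrightarrow>
      (real j + 2) * sum w S + Max {0, sum w S - p * M, (real p - 1) * (sum w S - (real j + 1) * M)}
        + 2 * \<mu> * (card R - ((real j + 1) * card S - real j * (real j + 1) / 2))
      \<le> (\<Sum>r\<in>R. w (fst r) + w (snd r))"
      using Suc.hyps(1)[OF cS[symmetric] S wS] by (elim exE conjE) (rule that)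
    have finR: "finite R" using R(1) S finite_subset by blast
    define \<Phi> where "\<Phi> = (\<Sum>r\<in>R. w (fst r) + w (snd r))"
    define \<sigma> where "\<sigma> = sum w S"
    define g where "g = Max {0, \<sigma> - p * M, (real p - 1) * (\<sigma> - (real j + 1) * M)}"
    define f where "f = (real j + 1) * n - real j * (real j + 1) / 2"
    have g: "0 \<le> g" "\<sigma> - p * M \<le> g" "(real p - 1) * (\<sigma> - (real j + 1) * M) \<le> g" by (simp_all add: g_def)
    \<comment> \<open>\<open>\<mu>\<close> is taken as the weight of the new point, which is
      admissible because \<open>t\<close> is lightest. As the surplus over Freiman's bound is
      nonnegative, the claim for smaller \<open>\<mu>\<close> follows.\<close>
    have IH: "(real j + 2) * \<sigma> + g + 2 * w t * (card R - f) \<le> \<Phi>"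
      using bound[rule_format, of "w t"] wt t(2) TS by (simp add: \<Phi>_def \<sigma>_def g_def f_def cS)
    have Rf: "f \<le> card R"
      using freiman_card_sums[OF S j finR] R(3) by (simp add: f_def cS)
    have \<sigma>T: "sum w T = \<sigma> + w t" using TS S by (simp add: \<sigma>_def)
    have \<sigma>M: "\<sigma> \<le> n * M" using sum_bounded_above[of S w M] wS by (simp add: \<sigma>_def cS)
    define Q where "Q = {u \<in> T. \<forall>a\<in>S. \<forall>b\<in>S. t + u \<noteq> a + b}"
    define N where "N = Pair t ` Q"
    have finQ: "finite Q" using Suc.prems(1) by (simp add: Q_def)
    have cN: "card N = card Q" by (simp add: N_def card_image inj_on_def)
    have disj: "R \<inter> N = {}" using R(1) TS by (auto simp: N_def)
    have RN: "R \<union> N \<subseteq> T \<times> T" using R(1) TS t(1) by (auto simp: N_def Q_def)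
    have inj: "inj_on (\<lambda>r. fst r + snd r) (R \<union> N)"
    proof -
      have "inj_on (\<lambda>r. fst r + snd r) N" by (auto simp: N_def inj_on_def)
      moreover have "(\<lambda>r. fst r + snd r) ` (R - N) \<inter> (\<lambda>r. fst r + snd r) ` (N - R) = {}"
      proof -
        have "t + u \<noteq> fst r + snd r" if "r \<in> R" "u \<in> Q" for r u
        proof -
          have "fst r \<in> S" "snd r \<in> S" using that(1) R(1) by auto
          then show ?thesis using that(2) by (simp add: Q_def)
        qed
        then show ?thesis by (fastforce simp: N_def)
      qed
      ultimately show ?thesis using R(2) by (simp add: inj_on_Un)
    qed
    have covt: "\<exists>r\<in>R \<union> N. fst r + snd r = t + u" if u: "u \<in> T" for u
    proof (cases "u \<in> Q")
      case True
      then show ?thesis by (intro bexI[of _ "(t, u)"]) (auto simp: N_def)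
    next
      case False
      then obtain a b where "a \<in> S" "b \<in> S" "t + u = a + b" using u by (auto simp: Q_def)
      then show ?thesis using R(3) by (metis UnI1)
    qed
    have cover: "\<exists>r\<in>R \<union> N. fst r + snd r = a + b" if "a \<in> T" "b \<in> T" for a b
    proof (cases "a = t \<or> b = t")
      case True
      then show ?thesis
      proof
        assume "a = t"
        then show ?thesis using covt[OF that(2)] by simp
      next
        assume "b = t"
        then show ?thesis using covt[OF that(1)] by (simp add: add.commute)
      qed
    next
      case False
      then have "a \<in> S" "b \<in> S" using that TS(1) by auto
      then show ?thesis using R(3) by blast
    qed
    have \<Phi>N: "(\<Sum>r\<in>R \<union> N. w (fst r) + w (snd r)) = \<Phi> + (card Q * w t + sum w Q)"
      using finR finQ disj by (subst sum.union_disjoint) (auto simp: N_def \<Phi>_def sum.reindex inj_on_def sum.distrib)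
    have cRN: "card (R \<union> N) = card R + card Q"
      using finR finQ disj cN by (simp add: card_Un_disjoint N_def)
    have "\<exists>p' j'. aff_dim T = int j' \<and> 1 \<le> p' \<and> p' \<le> j' + 1 \<and> (p' = n + 1 \<or> 2 \<le> p' \<and> j' + 2 \<le> n + 1) \<and>
      (\<forall>\<mu>\<ge>0. (\<forall>s\<in>T. \<mu> \<le> w s) \<longrightarrow>
      (real j' + 2) * (\<sigma> + w t) + Max {0, \<sigma> + w t - p' * M, (real p' - 1) * (\<sigma> + w t - (real j' + 1) * M)}
        + 2 * \<mu> * (real (card R + card Q) - ((real j' + 1) * (n + 1) - real j' * (real j' + 1) / 2))
      \<le> \<Phi> + (card Q * w t + sum w Q))"
    proof (cases "t \<in> affine hull S")
      case False
      have "Q = T"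
      proof -
        have "t + u \<noteq> a + b" if "u \<in> T" "a \<in> S" "b \<in> S" for u a b
        proof
          assume eq: "t + u = a + b"
          have ab: "a \<in> affine hull S" "b \<in> affine hull S" using that by (simp_all add: hull_inc)
          show False
          proof (cases "u = t")
            case True
            have "t = (1/2) *\<^sub>R (t + u)" using True by (simp flip: scaleR_2)
            also have "\<dots> = (1/2) *\<^sub>R a + (1/2) *\<^sub>R b" by (simp add: eq scaleR_right_distrib)
            finally show False using False ab mem_affine[OF affine_affine_hull ab, of "1/2" "1/2"] \<open>t \<notin> affine hull S\<close> by simp
          next
            case neq: False
            then have "u \<in> affine hull S" using that(1) TS by (auto simp: hull_inc)
            have "t = 1 *\<^sub>R a + 1 *\<^sub>R b + (-1) *\<^sub>R u" using eq by (simp add: algebra_simps)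
            moreover have "\<dots> \<in> affine hull S"
              using ab \<open>u \<in> affine hull S\<close> by (intro mem_affine_3) auto
            ultimately show False using \<open>t \<notin> affine hull S\<close> by simp
          qed
        qed
        then show ?thesis by (auto simp: Q_def)
      qed
      then have cQ: "card Q = n + 1" and sQ: "sum w Q = \<sigma> + w t" using cT \<sigma>T by simp_all
      have j': "aff_dim T = int (j + 1)" using False TS j by (simp add: aff_dim_insert)
      \<comment> \<open>\<open>p = card S\<close> means that \<open>S\<close> is still affinely
        independent, and then \<open>p\<close> grows along; later it stays fixed even when the
        dimension rises again.\<close>
      define p' where "p' = (if p = card S then n + 1 else p)"
      have jn: "int j + 1 \<le> n" using aff_dim_le_card[OF S(1)] j cS by simp
      have p': "1 \<le> p'" "p' \<le> j + 1 + 1" "p' = n + 1 \<or> 2 \<le> p' \<and> j + 1 + 2 \<le> n + 1"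
        using p cS by (auto simp: p'_def)
      \<comment> \<open>The new sums weigh \<open>(n + 1) * w t + \<sigma> + w t\<close>. Raising
        the main term costs \<open>\<sigma> + (j + 3) * w t\<close>, the Freiman surplus is
        unchanged, and the difference is what the \<open>Max\<close> may grow by.\<close>
      have g': "Max {0, \<sigma> + w t - p' * M, (real p' - 1) * (\<sigma> + w t - (real (j + 1) + 1) * M)} \<le> g + (real n - (real j + 1)) * w t"
      proof -
        have nj: "0 \<le> (real n - (real j + 1)) * w t" using jn wt by auto
        have 1: "\<sigma> + w t - p' * M \<le> g + (real n - (real j + 1)) * w t"
        proof (cases "p = card S")
          case True
          then have "\<sigma> + w t - p' * M \<le> 0" using \<sigma>M wt by (simp add: p'_def algebra_simps)
          then show ?thesis using g(1) nj by linarith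
        next
          case False
          then have "real j + 2 \<le> n" using p cS by auto
          then have "1 * w t \<le> (real n - (real j + 1)) * w t" using wt by (intro mult_right_mono) auto
          then show ?thesis using g(2) False by (simp add: p'_def)
        qed
        have 2: "(real p' - 1) * (\<sigma> + w t - (real (j + 1) + 1) * M) \<le> g + (real n - (real j + 1)) * w t"
        proof (cases "p = card S")
          case True
          then have "n \<le> j + 1" using p cS by simp
          then have "n * M \<le> (real j + 1) * M" using wt by (intro mult_right_mono) auto
          then have "\<sigma> + w t - (real (j + 1) + 1) * M \<le> 0" using \<sigma>M wt by (simp add: algebra_simps)
          then have "(real p' - 1) * (\<sigma> + w t - (real (j + 1) + 1) * M) \<le> 0"
            using p'(1) by (intro mult_nonneg_nonpos) auto
          then show ?thesis using g(1) nj by linarith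
        next
          case False
          have "(real p - 1) * (\<sigma> + w t - (real (j + 1) + 1) * M) \<le> (real p - 1) * (\<sigma> - (real j + 1) * M)"
            using p wt by (intro mult_left_mono) (auto simp: algebra_simps)
          then show ?thesis using g(3) nj False by (simp add: p'_def)
        qed
        have 0: "0 \<le> g + (real n - (real j + 1)) * w t" using g(1) nj by linarith
        show ?thesis using 0 1 2 by (simp only: Max_insert2 Max_le_iff finite.intros insert_not_empty ball_simps simp_thms)
      qed
      have "(real (j + 1) + 2) * (\<sigma> + w t) + Max {0, \<sigma> + w t - p' * M, (real p' - 1) * (\<sigma> + w t - (real (j + 1) + 1) * M)}
        + 2 * \<mu> * (real (card R + card Q) - ((real (j + 1) + 1) * (n + 1) - real (j + 1) * (real (j + 1) + 1) / 2))
        \<le> \<Phi> + (card Q * w t + sum w Q)" if \<mu>: "0 \<le> \<mu>" "\<forall>s\<in>T. \<mu> \<le> w s" for \<mu>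
      proof -
        have key: "js + s + jw + G + P \<le> ph + (nw + (s + x))"
          if "P \<le> P'" "js + g + P' \<le> ph" "G \<le> g + k" "k = nw + x - jw" for js s jw G P ph nw x P' k :: real
          using that by linarith
        have e1: "real (card R + card Q) - ((real (j + 1) + 1) * (n + 1) - real (j + 1) * (real (j + 1) + 1) / 2) = card R - f"
          by (simp add: cQ f_def field_simps)
        have e2: "2 * \<mu> * (card R - f) \<le> 2 * w t * (card R - f)"
          using \<mu> t(1) Rf by (intro mult_right_mono) auto
        have e4: "(real (j + 1) + 2) * (\<sigma> + w t) = (real j + 2) * \<sigma> + \<sigma> + (real j + 3) * w t"
          by (simp add: algebra_simps)
        have e5: "(real n - (real j + 1)) * w t = real (n + 1) * w t + w t - (real j + 3) * w t"
          by (simp add: algebra_simps)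
        show ?thesis unfolding e1 unfolding e4 cQ sQ by (rule key[OF e2 IH g' e5])
      qed
      then show ?thesis using j' p' by blast
    next
      case True
      have j': "aff_dim T = int j" using True TS j by (simp add: aff_dim_insert)
      have j1: "j \<ge> 1"
      proof (rule ccontr)
        assume "\<not> j \<ge> 1"
        then have "aff_dim S = 0" using j by simp
        then obtain a where "S = {a}" using aff_dim_eq_0 by blast
        then show False using True TS(2) by simp
      qed
      have jn: "int j + 1 \<le> n" using aff_dim_le_card[OF S(1)] j cS by simp
      have p': "2 \<le> p" "j + 2 \<le> n + 1" using p j1 jn cS by auto
      \<comment> \<open>Every new sum weighs at least \<open>2 * w t\<close>. After accounting for
        the surplus at this rate, \<open>j + 1\<close> sums remain, and
        \<open>2 * (j + 1) - (j + 2) = j\<close> copies of \<open>w t\<close> are left for the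
        \<open>Max\<close>. Its terms grow by at most 1 or \<open>p - 1\<close> copies, and both are
        at most \<open>j\<close>.\<close>
      have g': "Max {0, \<sigma> + w t - p * M, (real p - 1) * (\<sigma> + w t - (real j + 1) * M)} \<le> g + j * w t"
      proof -
        have "1 * w t \<le> j * w t" using j1 wt by (intro mult_right_mono) auto
        then have 1: "\<sigma> + w t - p * M \<le> g + j * w t" using g(2) by linarith
        have "(real p - 1) * w t \<le> j * w t" using p wt by (intro mult_right_mono) auto
        then have 2: "(real p - 1) * (\<sigma> + w t - (real j + 1) * M) \<le> g + j * w t"
          using g(3) by (simp add: algebra_simps)
        have 0: "0 \<le> g + j * w t" using g(1) wt by simp
        show ?thesis using 0 1 2 by (simp only: Max_le_iff finite.intros insert_not_empty ball_simps simp_thms)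
      qed
      have "(real j + 2) * (\<sigma> + w t) + Max {0, \<sigma> + w t - p * M, (real p - 1) * (\<sigma> + w t - (real j + 1) * M)}
        + 2 * \<mu> * (real (card R + card Q) - ((real j + 1) * (n + 1) - real j * (real j + 1) / 2))
        \<le> \<Phi> + (card Q * w t + sum w Q)" if \<mu>: "0 \<le> \<mu>" "\<forall>s\<in>T. \<mu> \<le> w s" for \<mu>
      proof -
        define x where "x = real (card R + card Q) - ((real j + 1) * (n + 1) - real j * (real j + 1) / 2)"
        have "finite (R \<union> N)" using finR finQ by (simp add: N_def)
        then have "0 \<le> x" using freiman_card_sums[OF Suc.prems(1,2) j' _ cover] cT cRN by (simp add: x_def)
        then have "2 * \<mu> * x \<le> 2 * w t * x" using \<mu> t(1) by (intro mult_right_mono) auto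
        moreover have "card Q * w t \<le> sum w Q"
          using sum_bounded_below[of Q "w t" w] t(2) by (simp add: Q_def)
        moreover have "2 * w t * x = 2 * w t * (card R - f) + 2 * (card Q * w t) - 2 * ((real j + 1) * w t)"
          by (simp add: x_def f_def field_simps)
        moreover have "(real j + 2) * (\<sigma> + w t) = (real j + 2) * \<sigma> + 2 * ((real j + 1) * w t) - j * w t"
          by (simp add: algebra_simps)
        moreover have "A + G + P \<le> ph + (q + q')"
          if "P \<le> P'" "q \<le> q'" "P' = r + 2 * q - 2 * jw" "A = js + 2 * jw - k" "js + g + r \<le> ph" "G \<le> g + k"
          for A G P P' ph q q' r jw js k :: real using that by linarith
        ultimately show ?thesis unfolding x_def[symmetric] using IH g' by blast
      qed
      then show ?thesis using j' p(1,2) p' by blast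
    qed
    then obtain p' j' where fin: "aff_dim T = int j'" "1 \<le> p'" "p' \<le> j' + 1" "p' = n + 1 \<or> 2 \<le> p' \<and> j' + 2 \<le> n + 1"
      "\<forall>\<mu>\<ge>0. (\<forall>s\<in>T. \<mu> \<le> w s) \<longrightarrow>
      (real j' + 2) * (\<sigma> + w t) + Max {0, \<sigma> + w t - p' * M, (real p' - 1) * (\<sigma> + w t - (real j' + 1) * M)}
        + 2 * \<mu> * (real (card R + card Q) - ((real j' + 1) * (n + 1) - real j' * (real j' + 1) / 2))
      \<le> \<Phi> + (card Q * w t + sum w Q)" by (elim exE conjE) (rule that)
    show ?thesis
    proof (rule exI[of _ "R \<union> N"], rule conjI[OF RN], rule exI[of _ p'], rule exI[of _ j'],
        unfold \<Phi>N cRN \<sigma>T cT, intro conjI)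
      show "\<forall>a\<in>T. \<forall>b\<in>T. \<exists>r\<in>R \<union> N. fst r + snd r = a + b" using cover by blast
    qed (fact inj fin)+
  qed
qed

text \<open>Let \<open>M\<close> be the largest weight and \<open>W\<close> the total. The sums of
  the heaviest point with all of \<open>T\<close> weigh \<open>card T * M + W\<close>, which
  suffices unless \<open>card T * M < (m + 9/8) * W\<close>. In that case no point dominates, as
  \<open>W \<ge> (m + 23/8) * M\<close>, and one of the last two terms of the \<open>Max\<close> in
  \<open>weighted_sums_growth\<close> reaches \<open>W / 8\<close>.\<close>

lemma many_weighted_sums:
  fixes T :: "'a::euclidean_space set" and w :: "'a \<Rightarrow> real"
  assumes T: "finite T" and m: "aff_dim T = int m" and many: "card T > (m + 2)\<^sup>2"
    and w: "\<And>t. t \<in> T \<Longrightarrow> w t > 0"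
  obtains R where "R \<subseteq> T \<times> T" "inj_on (\<lambda>r. fst r + snd r) R"
    "(real m + 2 + 1/8) * sum w T \<le> (\<Sum>r\<in>R. w (fst r) + w (snd r))"
proof -
  have Tne: "T \<noteq> {}" using many by auto
  obtain t where t: "t \<in> T" "\<And>s. s \<in> T \<Longrightarrow> w s \<le> w t"
    using finite_has_maximizer[OF T Tne, of w] by blast
  define M where "M = w t"
  define W where "W = sum w T"
  have M0: "M > 0" using w t by (simp add: M_def)
  show ?thesis
  proof (cases "(m + 9/8) * W \<le> card T * M")
    case True
    have "(\<Sum>r\<in>Pair t ` T. w (fst r) + w (snd r)) = card T * M + W"
      by (simp add: sum.reindex inj_on_def sum.distrib M_def W_def)
    then have "(real m + 2 + 1/8) * sum w T \<le> (\<Sum>r\<in>Pair t ` T. w (fst r) + w (snd r))"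
      using True by (simp add: W_def algebra_simps)
    then show ?thesis using t(1) by (intro that[of "Pair t ` T"]) (auto simp: inj_on_def)
  next
    case False
    \<comment> \<open>Since \<open>9/8 + 23/8 = 4\<close>, the product \<open>(m + 9/8) * x\<close>
      agrees with \<open>(m + 2)\<^sup>2\<close> up to a constant; the quadratic threshold for
      \<open>card T\<close> comes from here.\<close>
    define x where "x = m + 23/8"
    have x: "x \<ge> 23/8" by (simp add: x_def)
    have "(m + 2)\<^sup>2 + 1 \<le> card T" using many by simp
    then have "real ((m + 2)\<^sup>2 + 1) * M \<le> card T * M"
      using M0 by (intro mult_right_mono of_nat_mono) auto
    then have 1: "((real m + 2)\<^sup>2 + 1) * M < (m + 9/8) * W"
      using False by (simp only: of_nat_add of_nat_power of_nat_numeral of_nat_1 not_le)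
    have "(m + 9/8) * x \<le> (real m + 2)\<^sup>2 + 1" by (simp add: x_def power2_eq_square field_simps)
    from mult_right_mono[OF this, of M] have "(m + 9/8) * (x * M) \<le> ((real m + 2)\<^sup>2 + 1) * M"
      using M0 by (simp add: mult.assoc)
    then have "(m + 9/8) * (x * M) < (m + 9/8) * W" using 1 by linarith
    then have xM: "x * M \<le> W" by (simp add: mult_less_cancel_left)
    have wM: "\<forall>t\<in>T. 0 \<le> w t \<and> w t \<le> M" using w[THEN less_imp_le] t(2) by (simp add: M_def)
    obtain R p j where R: "R \<subseteq> T \<times> T" "inj_on (\<lambda>r. fst r + snd r) R"
      "\<forall>a\<in>T. \<forall>b\<in>T. \<exists>r\<in>R. fst r + snd r = a + b"
      and j: "aff_dim T = int j" and p: "1 \<le> p" "p \<le> j + 1" "p = card T \<or> 2 \<le> p \<and> j + 2 \<le> card T"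
      and bound: "\<forall>\<mu>\<ge>0. (\<forall>t\<in>T. \<mu> \<le> w t) \<longrightarrow>
      (real j + 2) * sum w T + Max {0, sum w T - p * M, (real p - 1) * (sum w T - (real j + 1) * M)}
        + 2 * \<mu> * (card R - ((real j + 1) * card T - real j * (real j + 1) / 2))
      \<le> (\<Sum>r\<in>R. w (fst r) + w (snd r))"
      using weighted_sums_growth[OF T Tne wM] by (elim exE conjE) (rule that)
    have jm: "j = m" using j m by simp
    define g where "g = Max {0, W - p * M, (real p - 1) * (W - (real m + 1) * M)}"
    have g: "W - p * M \<le> g" "(real p - 1) * (W - (real m + 1) * M) \<le> g" by (simp_all add: g_def)
    have le: "(real m + 2) * W + g \<le> (\<Sum>r\<in>R. w (fst r) + w (snd r))"
      using bound[rule_format, of 0] wM by (simp add: g_def W_def jm)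
    have "W / 8 \<le> g"
    proof (cases "p * M \<le> 7/8 * W")
      case True
      then show ?thesis using g(1) by linarith
    next
      case False
      \<comment> \<open>Now \<open>p\<close> is at least \<open>7/8 * x\<close>, so the last term of
        the \<open>Max\<close> has a large factor, while \<open>W - (m + 1) * M\<close> is still at
        least \<open>15/8 * (W / x)\<close>.\<close>
      have "7/8 * x * M \<le> 7/8 * W" using mult_left_mono[OF xM, of "7/8"] by simp
      also have "\<dots> \<le> p * M" using False by simp
      finally have px: "7/8 * x \<le> p" using M0 by simp
      have "x * M > 0" using x M0 by simp
      then have W0: "W > 0" using xM by linarith
      have "M \<le> W / x" using xM x by (simp add: pos_le_divide_eq mult.commute)
      then have "(real m + 1) * M \<le> (real m + 1) * (W / x)" by (intro mult_left_mono) auto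
      moreover have "real m + 1 = x - 15/8" by (simp add: x_def)
      ultimately have "(real m + 1) * M \<le> (x - 15/8) * (W / x)" by simp
      also have "\<dots> = W - 15/8 * (W / x)" using x by (simp add: field_simps)
      finally have "15/8 * (W / x) \<le> W - (real m + 1) * M" by simp
      then have "(7/8 * x - 1) * (15/8 * (W / x)) \<le> (real p - 1) * (W - (real m + 1) * M)"
        using px x W0 by (intro mult_mono) auto
      moreover have "W / 8 \<le> (7/8 * x - 1) * (15/8 * (W / x))" using x W0 by (simp add: field_simps)
      ultimately show ?thesis using g(2) by linarith
    qed
    then have "(real m + 2 + 1/8) * sum w T \<le> (\<Sum>r\<in>R. w (fst r) + w (snd r))"
      using le by (simp add: W_def algebra_simps)
    then show ?thesis by (rule that[OF R(1,2)])
  qed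
qed

section \<open>Sets covered by few translates of a subspace\<close>

lemma dim_kernel_range:
  fixes q :: "'a::euclidean_space \<Rightarrow> 'b::euclidean_space"
  assumes q: "linear q"
  shows "dim (range q) + dim {v. q v = 0} = DIM('a)"
proof -
  define N where "N = {v. q v = 0}"
  define P where "P = {y \<in> UNIV. \<forall>x\<in>N. orthogonal x y}"
  have N: "subspace N" unfolding N_def using q by (rule linear_subspace_kernel)
  have P: "subspace P" by (simp add: P_def subspace_orthogonal_to_vectors)
  have "inj_on q P"
  proof (rule inj_onI)
    fix x y assume xy: "x \<in> P" "y \<in> P" "q x = q y"
    then have "x - y \<in> N" using q by (simp add: N_def linear_diff)
    moreover have "x - y \<in> P" using P xy by (simp add: subspace_diff)
    ultimately have "orthogonal (x - y) (x - y)" by (simp add: P_def)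
    then show "x = y" by (simp add: orthogonal_def)
  qed
  then have "dim (q ` P) = dim P"
    using q P by (intro dim_image_eq) (metis span_eq_iff)+
  moreover have "q ` P = range q"
  proof -
    have "q v \<in> q ` P" for v
    proof -
      obtain y z where yz: "y \<in> span N" "\<And>w. w \<in> span N \<Longrightarrow> orthogonal z w" "v = y + z"
        using orthogonal_subspace_decomp_exists by blast
      then have "y \<in> N" using N by (metis span_eq_iff)
      moreover have "z \<in> P" using yz(2) by (simp add: P_def orthogonal_commute span_base)
      ultimately show ?thesis using q yz(3) by (auto simp: N_def linear_add)
    qed
    then show ?thesis by auto
  qed
  moreover have "dim P + dim N = DIM('a)"
    unfolding P_def using dim_subspace_orthogonal_to_vectors[OF N subspace_UNIV] by simp
  ultimately show ?thesis by (simp add: N_def)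
qed

lemma aff_dim_linear_image:
  fixes q :: "'a::euclidean_space \<Rightarrow> 'b::euclidean_space"
  assumes q: "linear q" and A: "aff_dim A = DIM('a)"
  shows "aff_dim (q ` A) + dim {v. q v = 0} = DIM('a)"
proof -
  have "affine hull A = UNIV" using A by (simp add: aff_dim_eq_full)
  then have "affine hull (q ` A) = range q"
    using affine_hull_linear_image[of q A] q by (simp add: linear_conv_bounded_linear)
  then have "aff_dim (q ` A) = aff_dim (range q)" by (metis aff_dim_affine_hull)
  also have "\<dots> = dim (range q)"
    using q by (intro aff_dim_subspace linear_subspace_image subspace_UNIV)
  finally show ?thesis using dim_kernel_range[OF q] by linarith
qed

text \<open>If \<open>k\<close> fibres of \<open>q\<close> are met by \<open>A\<close>, then \<open>k\<close> suitable translates of one fibre are disjoint.\<close>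

lemma fibre_bound:
  fixes A :: "'a::euclidean_space set" and K :: real
  assumes A: "finite A" and q: "linear q"
    and small: "\<And>C. C \<subseteq> A \<Longrightarrow> C \<noteq> {} \<Longrightarrow> card C \<le> c \<Longrightarrow> card (A + C) \<le> K * card A"
    and k: "0 < k" "k \<le> c" "k \<le> card (q ` A)"
  shows "k * card {a \<in> A. q a = y} \<le> K * card A"
proof -
  obtain B where "B \<subseteq> q ` A" "card B = k" using obtain_subset_with_card_n[OF k(3)] by blast
  then obtain C where C: "C \<subseteq> A" "inj_on q C" "B = q ` C" by (auto simp: subset_image_inj)
  then have cC: "card C = k" using \<open>card B = k\<close> by (simp add: card_image)
  have finC: "finite C" using C A finite_subset by blast
  define F where "F = {a \<in> A. q a = y}"
  have "inj_on (\<lambda>(a, c). a + c) (F \<times> C)"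
  proof (rule inj_onI, clarify)
    fix a c b d assume *: "a \<in> F" "c \<in> C" "b \<in> F" "d \<in> C" "a + c = b + d"
    then have "q a + q c = q b + q d" using q by (metis linear_add)
    then have "q c = q d" using * by (simp add: F_def)
    then have "c = d" using C(2) * by (simp add: inj_on_def)
    then show "a = b \<and> c = d" using * by simp
  qed
  then have "card F * k = card ((\<lambda>(a, c). a + c) ` (F \<times> C))"
    by (simp add: card_image card_cartesian_product cC)
  also have "\<dots> \<le> card (A + C)"
    using A finC by (intro card_mono finite_set_plus) (auto simp: F_def set_plus_def)
  finally have "k * card F \<le> card (A + C)" by (simp add: mult.commute)
  then have "real (k * card F) \<le> card (A + C)" by (rule of_nat_mono)
  also have "\<dots> \<le> K * card A" using C(1) cC k by (intro small) auto
  finally show ?thesis by (simp add: F_def)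
qed

text \<open>The larger set is translated by elements of the smaller one; the minimum in
  \<open>three_translates\<close> is then the smaller size minus 1.\<close>

lemma pair_translates:
  fixes X Y :: "'a::euclidean_space set"
  assumes "finite X" "finite Y" "X \<noteq> {}" "Y \<noteq> {}"
  shows "\<exists>P D. (P = X \<and> D \<subseteq> Y \<or> P = Y \<and> D \<subseteq> X) \<and> card D \<le> 3 \<and> card X + card Y \<le> card (P + D) + 1"
proof -
  have *: "\<exists>D\<subseteq>Y. card D \<le> 3 \<and> card X + card Y \<le> card (X + D) + 1"
    if fin: "finite X" "finite Y" and Y: "Y \<noteq> {}" "card Y \<le> card X" for X Y :: "'a set"
  proof -
    obtain D where D: "D \<subseteq> Y" "card D \<le> 3"
      "(\<Sum>i\<in>{()}. card X + min (card X) (card Y - 1)) \<le> (\<Sum>i\<in>{()}. card (X + D))"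
      by (rule three_translates[OF fin(2) Y(1), of "{()}" "\<lambda>_. X"]) (use fin in auto)
    moreover have "min (card X) (card Y - 1) = card Y - 1" using Y(2) by simp
    ultimately have "card X + card Y \<le> card (X + D) + 1" by simp
    with D show ?thesis by blast
  qed
  show ?thesis
  proof (cases "card Y \<le> card X")
    case True
    with *[of X Y] assms show ?thesis by blast
  next
    case False
    with *[of Y X] assms show ?thesis by (metis add.commute nat_le_linear)
  qed
qed

text \<open>Pairs with different sums place their partial sumsets in different fibres of
  \<open>q\<close>, so the bounds add up. \<open>h\<close> is left open so that a fibre paired with
  itself can use its own expansion, and other pairs the bound of \<open>pair_fibres\<close>.\<close>

lemma sumset_from_pairs:
  fixes A :: "'a::euclidean_space set" and q :: "'a \<Rightarrow> 'a"
  assumes A: "finite A" and q: "linear q" and R: "finite R" "inj_on (\<lambda>r. fst r + snd r) R"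
    and pieces: "\<And>r. r \<in> R \<Longrightarrow> \<exists>P D. card D \<le> d \<and> h r \<le> real (card (P + D)) \<and>
       (P \<subseteq> {a \<in> A. q a = fst r} \<and> D \<subseteq> {a \<in> A. q a = snd r} \<or>
        P \<subseteq> {a \<in> A. q a = snd r} \<and> D \<subseteq> {a \<in> A. q a = fst r})"
  obtains C where "C \<subseteq> A" "card C \<le> d * card R" "(\<Sum>r\<in>R. h r) \<le> card (A + C)"
proof -
  have "\<forall>r\<in>R. \<exists>z. card (snd z) \<le> d \<and> h r \<le> real (card (fst z + snd z)) \<and> fst z \<subseteq> A \<and> snd z \<subseteq> A \<and>
      (\<forall>a\<in>fst z. \<forall>c\<in>snd z. q (a + c) = fst r + snd r)"
  proof
    fix r assume "r \<in> R"
    from pieces[OF this] obtain P D where PD: "card D \<le> d" "h r \<le> real (card (P + D))"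
       "P \<subseteq> {a \<in> A. q a = fst r} \<and> D \<subseteq> {a \<in> A. q a = snd r} \<or>
        P \<subseteq> {a \<in> A. q a = snd r} \<and> D \<subseteq> {a \<in> A. q a = fst r}" by blast
    have "q (a + c) = fst r + snd r" if "a \<in> P" "c \<in> D" for a c
    proof -
      have "q a = fst r \<and> q c = snd r \<or> q a = snd r \<and> q c = fst r" using PD(3) that by blast
      then show ?thesis using linear_add[OF q, of a c] by (auto simp: add.commute)
    qed
    then show "\<exists>z. card (snd z) \<le> d \<and> h r \<le> real (card (fst z + snd z)) \<and> fst z \<subseteq> A \<and> snd z \<subseteq> A \<and>
      (\<forall>a\<in>fst z. \<forall>c\<in>snd z. q (a + c) = fst r + snd r)"
      using PD by (intro exI[of _ "(P, D)"]) auto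
  qed
  from bchoice[OF this] obtain z where z: "\<forall>r\<in>R. card (snd (z r)) \<le> d \<and> h r \<le> real (card (fst (z r) + snd (z r))) \<and>
      fst (z r) \<subseteq> A \<and> snd (z r) \<subseteq> A \<and> (\<forall>a\<in>fst (z r). \<forall>c\<in>snd (z r). q (a + c) = fst r + snd r)" ..
  define C where "C = (\<Union>r\<in>R. snd (z r))"
  have CA: "C \<subseteq> A" using z by (auto simp: C_def)
  have "card C \<le> (\<Sum>r\<in>R. card (snd (z r)))" unfolding C_def by (rule card_UN_le[OF R(1)])
  also have "\<dots> \<le> (\<Sum>r\<in>R. d)" using z by (intro sum_mono) blast
  finally have cC: "card C \<le> d * card R" by (simp add: mult.commute)
  define \<rho> where "\<rho> = the_inv_into R (\<lambda>r. fst r + snd r)"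
  have \<rho>: "\<rho> (fst r + snd r) = r" if "r \<in> R" for r
    unfolding \<rho>_def using the_inv_into_f_f[OF R(2) that] by simp
  have "(\<Sum>r\<in>R. h r) \<le> (\<Sum>r\<in>R. real (card (fst (z r) + snd (z r))))"
    using z by (intro sum_mono) blast
  also have "\<dots> = real (\<Sum>s\<in>(\<lambda>r. fst r + snd r) ` R. card (fst (z (\<rho> s)) + snd (z (\<rho> s))))"
    by (simp add: sum.reindex[OF R(2)] \<rho>)
  also have "(\<Sum>s\<in>(\<lambda>r. fst r + snd r) ` R. card (fst (z (\<rho> s)) + snd (z (\<rho> s)))) \<le> card (A + C)"
  proof (rule card_fibre_sums[where q = q])
    show "finite C" using CA A finite_subset by blast
    fix s assume "s \<in> (\<lambda>r. fst r + snd r) ` R"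
    then obtain r where r: "r \<in> R" "s = fst r + snd r" by blast
    have zr: "fst (z r) \<subseteq> A" "snd (z r) \<subseteq> C" "\<forall>a\<in>fst (z r). \<forall>c\<in>snd (z r). q (a + c) = fst r + snd r"
      using z r(1) by (auto simp: C_def)
    show "fst (z (\<rho> s)) \<subseteq> A" "snd (z (\<rho> s)) \<subseteq> C" using zr r by (simp_all add: \<rho>)
    show "q (a + c) = s" if "a \<in> fst (z (\<rho> s))" "c \<in> snd (z (\<rho> s))" for a c
      using that zr(3) r by (simp add: \<rho>)
  qed (use A R in auto)
  finally show ?thesis using that[OF CA cC] by simp
qed

lemma sum_card_fibres: "finite A \<Longrightarrow> (\<Sum>t\<in>q ` A. card {a \<in> A. q a = t}) = card A"
  using sum.image_gen[of A "\<lambda>_. 1::nat" q] by simp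

lemma pair_fibres:
  fixes A :: "'a::euclidean_space set"
  assumes A: "finite A" and r: "r \<in> q ` A \<times> q ` A" and d: "3 \<le> d"
  shows "\<exists>P D. card D \<le> d \<and>
      real (card {a \<in> A. q a = fst r}) + real (card {a \<in> A. q a = snd r}) - 1 \<le> real (card (P + D)) \<and>
       (P \<subseteq> {a \<in> A. q a = fst r} \<and> D \<subseteq> {a \<in> A. q a = snd r} \<or>
        P \<subseteq> {a \<in> A. q a = snd r} \<and> D \<subseteq> {a \<in> A. q a = fst r})"
proof -
  have "{a \<in> A. q a = fst r} \<noteq> {}" "{a \<in> A. q a = snd r} \<noteq> {}" using r by auto
  then obtain P D where PD: "P = {a \<in> A. q a = fst r} \<and> D \<subseteq> {a \<in> A. q a = snd r} \<or>
        P = {a \<in> A. q a = snd r} \<and> D \<subseteq> {a \<in> A. q a = fst r}" "card D \<le> 3"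
     "card {a \<in> A. q a = fst r} + card {a \<in> A. q a = snd r} \<le> card (P + D) + 1"
    using pair_translates[of "{a \<in> A. q a = fst r}" "{a \<in> A. q a = snd r}"] A by auto
  have "real (card {a \<in> A. q a = fst r}) + real (card {a \<in> A. q a = snd r}) - 1 \<le> real (card (P + D))"
    using PD(3) by linarith
  then show ?thesis using PD(1,2) d by (intro exI[of _ P] exI[of _ D]) auto
qed

text \<open>The weights are the fibre sizes; each of the at most quadratically many pairs loses
  1.\<close>

lemma many_lines_expand:
  fixes A :: "'a::euclidean_space set" and q :: "'a \<Rightarrow> 'a"
  assumes A: "finite A" and q: "linear q" and m: "aff_dim (q ` A) = int m"
    and many: "card (q ` A) > (m + 2)\<^sup>2"
  obtains C where "C \<subseteq> A" "card C \<le> 3 * (card (q ` A))\<^sup>2"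
    "(real m + 2 + 1/8) * card A - (real (card (q ` A)))\<^sup>2 \<le> card (A + C)"
proof -
  define w where "w t = real (card {a \<in> A. q a = t})" for t
  have w0: "w t > 0" if "t \<in> q ` A" for t using that A by (auto simp: w_def card_gt_0_iff)
  have sumw: "sum w (q ` A) = card A"
    using sum_card_fibres[OF A, of q] by (simp add: w_def flip: of_nat_sum)
  have finT: "finite (q ` A)" using A by simp
  obtain R where R: "R \<subseteq> q ` A \<times> q ` A" "inj_on (\<lambda>r. fst r + snd r) R"
    "(real m + 2 + 1/8) * sum w (q ` A) \<le> (\<Sum>r\<in>R. w (fst r) + w (snd r))"
    using many_weighted_sums[of "q ` A" m w, OF finT m many w0] by blast
  have finR: "finite R" using R(1) finT by (meson finite_SigmaI finite_subset)
  have cR: "card R \<le> (card (q ` A))\<^sup>2"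
    using card_mono[OF _ R(1)] finT by (simp add: card_cartesian_product power2_eq_square)
  obtain C where C: "C \<subseteq> A" "card C \<le> 3 * card R"
    "(\<Sum>r\<in>R. w (fst r) + w (snd r) - 1) \<le> card (A + C)"
  proof (rule sumset_from_pairs[OF A q finR R(2), of 3 "\<lambda>r. w (fst r) + w (snd r) - 1"])
    fix r assume "r \<in> R"
    then have "r \<in> q ` A \<times> q ` A" using R(1) by blast
    from pair_fibres[OF A this, of 3] show "\<exists>P D. card D \<le> 3 \<and> w (fst r) + w (snd r) - 1 \<le> real (card (P + D)) \<and>
       (P \<subseteq> {a \<in> A. q a = fst r} \<and> D \<subseteq> {a \<in> A. q a = snd r} \<or>
        P \<subseteq> {a \<in> A. q a = snd r} \<and> D \<subseteq> {a \<in> A. q a = fst r})" by (simp add: w_def)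
  qed
  have "(\<Sum>r\<in>R. w (fst r) + w (snd r) - 1) = (\<Sum>r\<in>R. w (fst r) + w (snd r)) - card R"
    by (simp add: sum_subtractf)
  moreover have "real (card R) \<le> (real (card (q ` A)))\<^sup>2" using of_nat_mono[OF cR, where 'a=real] by simp
  ultimately have "(real m + 2 + 1/8) * card A - (real (card (q ` A)))\<^sup>2 \<le> card (A + C)"
    using C(3) R(3) unfolding sumw by linarith
  moreover have "card C \<le> 3 * (card (q ` A))\<^sup>2" using C(2) cR by linarith
  ultimately show ?thesis using that C(1) by blast
qed

text \<open>The pairs of \<open>distinct_sums_graph\<close> contribute the affine dimension times
  \<open>card A\<close>. The doubles avoid their sums, so the pairs \<open>(t, t)\<close> add
  \<open>K\<close> times the total size of the fibres; fibres lighter than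
  \<open>\<rho> * card A\<close> are left out there.\<close>

lemma expanding_fibres_expand:
  fixes A :: "'a::euclidean_space set" and q :: "'a \<Rightarrow> 'a" and K \<rho> :: real
  assumes A: "finite A" "A \<noteq> {}" and q: "linear q" and K: "K \<ge> 0" and \<rho>: "\<rho> \<ge> 0"
    and expand: "\<And>t. t \<in> q ` A \<Longrightarrow> \<rho> * card A \<le> card {a \<in> A. q a = t} \<Longrightarrow> expands c K {a \<in> A. q a = t}"
  obtains C where "C \<subseteq> A" "card C \<le> (c + 3) * (card (q ` A) + (card (q ` A))\<^sup>2)"
    "(K * (1 - card (q ` A) * \<rho>) + aff_dim (q ` A)) * card A - (real (card (q ` A)))\<^sup>2 \<le> card (A + C)"
proof -
  define w where "w t = real (card {a \<in> A. q a = t})" for t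
  have sumw: "sum w (q ` A) = card A"
    using sum_card_fibres[OF A(1), of q] by (simp add: w_def flip: of_nat_sum)
  have finT: "finite (q ` A)" "q ` A \<noteq> {}" using A by simp_all
  obtain E where E: "E \<subseteq> q ` A \<times> q ` A" "inj_on (\<lambda>r. fst r + snd r) E"
    "\<forall>r\<in>E. \<forall>t\<in>q ` A. fst r + snd r \<noteq> t + t"
    "\<forall>w :: 'a \<Rightarrow> real. (\<forall>t\<in>q ` A. 0 \<le> w t) \<longrightarrow> aff_dim (q ` A) * sum w (q ` A) \<le> (\<Sum>r\<in>E. w (fst r) + w (snd r))"
    using distinct_sums_graph[OF finT] by (elim exE conjE) (rule that)
  have finE: "finite E" using E(1) finT by (meson finite_SigmaI finite_subset)
  have cE: "card E \<le> (card (q ` A))\<^sup>2"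
    using card_mono[OF _ E(1)] finT by (simp add: card_cartesian_product power2_eq_square)
  define B where "B = {t \<in> q ` A. \<rho> * card A \<le> w t}"
  define D where "D = (\<lambda>t. (t, t)) ` B"
  have finB: "finite B" using finT by (simp add: B_def)
  have cD: "card D = card B" by (simp add: D_def card_image inj_on_def)
  have cB: "card B \<le> card (q ` A)" using finT by (intro card_mono) (auto simp: B_def)
  have BT: "B \<subseteq> q ` A" by (auto simp: B_def)
  have disj: "E \<inter> D = {}"
  proof -
    have "t \<in> q ` A \<Longrightarrow> (t, t) \<notin> E" for t using E(3) by fastforce
    then show ?thesis using BT by (auto simp: D_def)
  qed
  have inj: "inj_on (\<lambda>r. fst r + snd r) (E \<union> D)"
  proof -
    have "inj_on (\<lambda>r. fst r + snd r) D" by (auto simp: D_def inj_on_def simp flip: scaleR_2)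
    moreover have "(\<lambda>r. fst r + snd r) ` (E - D) \<inter> (\<lambda>r. fst r + snd r) ` (D - E) = {}"
    proof -
      have "fst r + snd r \<noteq> fst s + snd s" if "r \<in> E" "s \<in> D" for r s
      proof -
        obtain t where t: "t \<in> B" "s = (t, t)" using \<open>s \<in> D\<close> by (auto simp: D_def)
        then have "t \<in> q ` A" using BT by blast
        from E(3)[rule_format, OF that(1) this] show ?thesis using t(2) by simp
      qed
      then show ?thesis by blast
    qed
    ultimately show ?thesis using E(2) by (simp add: inj_on_Un)
  qed
  define h where "h r = (if r \<in> D then K * w (fst r) else w (fst r) + w (snd r) - 1)" for r
  have finED: "finite (E \<union> D)" using finE finB by (simp add: D_def)
  obtain C where C: "C \<subseteq> A" "card C \<le> (c + 3) * card (E \<union> D)"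
    "(\<Sum>r\<in>E \<union> D. h r) \<le> card (A + C)"
  proof (rule sumset_from_pairs[OF A(1) q finED inj, of "c + 3" h])
    fix r assume r: "r \<in> E \<union> D"
    show "\<exists>P F. card F \<le> c + 3 \<and> h r \<le> real (card (P + F)) \<and>
       (P \<subseteq> {a \<in> A. q a = fst r} \<and> F \<subseteq> {a \<in> A. q a = snd r} \<or>
        P \<subseteq> {a \<in> A. q a = snd r} \<and> F \<subseteq> {a \<in> A. q a = fst r})"
    proof (cases "r \<in> D")
      case True
      then obtain t where t: "t \<in> B" "r = (t, t)" by (auto simp: D_def)
      then have "expands c K {a \<in> A. q a = t}" by (intro expand) (auto simp: B_def w_def)
      then obtain F where "F \<subseteq> {a \<in> A. q a = t}" "card F \<le> c" "K * w t \<le> card ({a \<in> A. q a = t} + F)"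
        unfolding expands_def w_def by blast
      then show ?thesis using True t by (intro exI[of _ "{a \<in> A. q a = t}"] exI[of _ F]) (auto simp: h_def)
    next
      case False
      then have "r \<in> q ` A \<times> q ` A" using r E(1) by blast
      from pair_fibres[OF A(1) this, of "c + 3"] False show ?thesis by (simp add: w_def h_def)
    qed
  qed
  have "(\<Sum>r\<in>E \<union> D. h r) = (\<Sum>r\<in>E. h r) + (\<Sum>r\<in>D. h r)"
    using finED disj by (intro sum.union_disjoint) auto
  also have "(\<Sum>r\<in>E. h r) = (\<Sum>r\<in>E. w (fst r) + w (snd r) - 1)"
    using disj by (intro sum.cong) (auto simp: h_def)
  also have "\<dots> = (\<Sum>r\<in>E. w (fst r) + w (snd r)) - card E" by (simp add: sum_subtractf)
  also have "(\<Sum>r\<in>D. h r) = K * sum w B"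
    by (simp add: D_def sum.reindex inj_on_def h_def sum_distrib_left)
  finally have h: "(\<Sum>r\<in>E \<union> D. h r) = (\<Sum>r\<in>E. w (fst r) + w (snd r)) - card E + K * sum w B" .
  have "sum w (q ` A) = sum w B + sum w (q ` A - B)"
    using finT by (subst sum.subset_diff[of B]) (auto simp: B_def)
  moreover have "sum w (q ` A - B) \<le> card (q ` A) * (\<rho> * card A)"
  proof -
    have "sum w (q ` A - B) \<le> card (q ` A - B) * (\<rho> * card A)"
      by (rule sum_bounded_above) (auto simp: B_def)
    also have "\<dots> \<le> card (q ` A) * (\<rho> * card A)"
      using finT \<rho> by (intro mult_right_mono of_nat_mono card_mono) auto
    finally show ?thesis .
  qed
  ultimately have "card A - card (q ` A) * (\<rho> * card A) \<le> sum w B" using sumw by linarith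
  then have "K * ((1 - card (q ` A) * \<rho>) * card A) \<le> K * sum w B"
    using K by (intro mult_left_mono) (auto simp: algebra_simps)
  moreover have "aff_dim (q ` A) * card A \<le> (\<Sum>r\<in>E. w (fst r) + w (snd r))"
    using E(4)[rule_format, of w] sumw by (simp add: w_def)
  moreover have "real (card E) \<le> (real (card (q ` A)))\<^sup>2" using of_nat_mono[OF cE, where 'a=real] by simp
  moreover have "(K * (1 - card (q ` A) * \<rho>) + aff_dim (q ` A)) * card A
      = K * ((1 - card (q ` A) * \<rho>) * card A) + aff_dim (q ` A) * card A"
    by (simp add: algebra_simps)
  ultimately have 1: "(K * (1 - card (q ` A) * \<rho>) + aff_dim (q ` A)) * card A - (real (card (q ` A)))\<^sup>2 \<le> card (A + C)"
    using C(3) h by linarith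
  have "card (E \<union> D) \<le> card (q ` A) + (card (q ` A))\<^sup>2"
    using card_Un_le[of E D] cE cD cB by linarith
  then have "(c + 3) * card (E \<union> D) \<le> (c + 3) * (card (q ` A) + (card (q ` A))\<^sup>2)" by (rule mult_le_mono2)
  then have "card C \<le> (c + 3) * (card (q ` A) + (card (q ` A))\<^sup>2)" using C(2) by linarith
  with 1 that C(1) show ?thesis by blast
qed

section \<open>Choice of the covering subspace\<close>

lemma few_lines_or_expand:
  "\<exists>(c::nat) (C::real). 1 \<le> c \<and> 0 < C \<and> (\<forall>A :: 'a::euclidean_space set. finite A \<longrightarrow> A \<noteq> {} \<longrightarrow>
     aff_dim A = DIM('a) \<longrightarrow>
     (\<forall>S\<subseteq>A. S \<noteq> {} \<longrightarrow> card S \<le> c \<longrightarrow> card (A + S) \<le> (real DIM('a) + 1 + 1/16) * card A) \<longrightarrow>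
     card A \<le> C \<or>
     (\<exists>q :: 'a \<Rightarrow> 'a. linear q \<and> dim {v. q v = 0} = 1 \<and> card (q ` A) \<le> (DIM('a) + 1)\<^sup>2))"
proof -
  define d where "d = DIM('a)"
  define K where "K = real d + 1 + 1/16"
  have K0: "K > 0" by (simp add: K_def)
  \<comment> \<open>This loss of \<open>1/4\<close> and another \<open>1/4\<close> from light fibres
    leave the factor \<open>2 ^ h + d - h - 1/2\<close>, which is at least \<open>d + 3/2\<close>
    for \<open>h \<ge> 2\<close>.\<close>
  have "\<forall>h. \<exists>z :: real \<times> nat. fst z > 0 \<and> (\<forall>X :: 'a set. finite X \<longrightarrow> X \<noteq> {} \<longrightarrow>
      nondegenerate h (fst z) X \<longrightarrow> expands (snd z) (2 ^ h - 1/4) X)"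
    using nondegenerate_expands[of "1/4", where 'a='a] by fastforce
  from choice[OF this] obtain z :: "nat \<Rightarrow> real \<times> nat" where
    z: "\<And>h. fst (z h) > 0" "\<And>h X :: 'a set. finite X \<Longrightarrow> X \<noteq> {} \<Longrightarrow>
      nondegenerate h (fst (z h)) X \<Longrightarrow> expands (snd (z h)) (2 ^ h - 1/4) X" by blast
  \<comment> \<open>The index is the codimension. With \<open>h = d - i\<close> and the cut-off
    \<open>\<rho> = 1 / (4 * 2 ^ h * r)\<close> used below, the new bound is at least
    \<open>K / (fst (z h) * \<rho>)\<close>, so that minimality of \<open>h\<close> makes fibres of
    at least \<open>\<rho> * card A\<close> elements nondegenerate.\<close>
  define F where "F i r = r + nat \<lceil>K * (4 * 2 ^ (d - i) * r) / fst (z (d - i))\<rceil>" for i r :: nat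
  define k where "k = rec_nat 1 F"
  have k0: "k 0 = 1" and kS: "k (Suc i) = F i (k i)" for i by (simp_all add: k_def)
  have kmono: "i \<le> j \<Longrightarrow> k i \<le> k j" for i j
    by (rule lift_Suc_mono_le) (simp_all add: kS F_def)
  have k1: "k i \<ge> 1" for i using kmono[of 0 i] k0 by simp
  have kbig: "K * (4 * 2 ^ h * k (d - h)) / fst (z h) \<le> k (d - (h - 1))" if "1 \<le> h" "h \<le> d" for h
  proof -
    have "d - (h - 1) = Suc (d - h)" "d - (d - h) = h" using that by auto
    then have "k (d - (h - 1)) = k (d - h) + nat \<lceil>K * (4 * 2 ^ h * k (d - h)) / fst (z h)\<rceil>"
      by (simp add: kS F_def)
    then show ?thesis using real_nat_ceiling_ge[of "K * (4 * 2 ^ h * k (d - h)) / fst (z h)"] by linarith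
  qed
  define k' where "k' = k d"
  have kk': "k (d - h) \<le> k'" for h by (simp add: k'_def kmono)
  define s where "s = (\<Sum>h\<le>d. snd (z h))"
  define c where "c = 1 + k' + 3 * k'\<^sup>2 + (s + 3) * (k' + k'\<^sup>2)"
  \<comment> \<open>16 is the inverse of \<open>1/8 - 1/16\<close>, the slack that has to beat the
    error \<open>\<kappa>\<^sup>2\<close>.\<close>
  define C where "C = 16 * (real k')\<^sup>2 + 1"
  have main: "\<exists>q :: 'a \<Rightarrow> 'a. linear q \<and> dim {v. q v = 0} = 1 \<and> card (q ` A) \<le> (d + 1)\<^sup>2"
    if A: "finite A" "A \<noteq> {}" "aff_dim A = d" and large: "\<not> card A \<le> C"
      and small: "\<forall>S\<subseteq>A. S \<noteq> {} \<longrightarrow> card S \<le> c \<longrightarrow> card (A + S) \<le> K * card A" for A :: "'a set"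
  proof -
    have small': "card (A + S) \<le> K * card A" if "S \<subseteq> A" "card S \<le> c" for S
      using small that K0 by (cases "S = {}") auto
    define P where "P h \<longleftrightarrow> (\<exists>q :: 'a \<Rightarrow> 'a. linear q \<and> dim {v. q v = 0} = h \<and> card (q ` A) \<le> k (d - h))" for h
    have "P d"
    proof -
      have "linear (\<lambda>v::'a. 0::'a)" by (rule linearI) auto
      moreover have "dim {v::'a. (0::'a) = 0} = d" by (simp add: d_def)
      moreover have "card ((\<lambda>v. 0::'a) ` A) \<le> k (d - d)" using A(2) by (simp add: k0 image_constant_conv)
      ultimately show ?thesis unfolding P_def by blast
    qed
    define h where "h = (LEAST h. P h)"
    have "P h" unfolding h_def using \<open>P d\<close> by (rule LeastI)
    then obtain q :: "'a \<Rightarrow> 'a" where q: "linear q" "dim {v. q v = 0} = h" "card (q ` A) \<le> k (d - h)"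
      unfolding P_def by blast
    have hd: "h \<le> d" unfolding h_def using \<open>P d\<close> by (rule Least_le)
    define \<kappa> where "\<kappa> = card (q ` A)"
    have \<kappa>: "\<kappa> \<le> k'" using q(3) kk'[of h] by (simp add: \<kappa>_def)
    have \<kappa>2: "\<kappa>\<^sup>2 \<le> k'\<^sup>2" using \<kappa> by (simp add: power_mono)
    have big: "16 * (real \<kappa>)\<^sup>2 < card A"
    proof -
      have "(real \<kappa>)\<^sup>2 \<le> (real k')\<^sup>2" using \<kappa> by (intro power_mono) auto
      then show ?thesis using large unfolding C_def by linarith
    qed
    have m: "aff_dim (q ` A) = int (d - h)"
      using aff_dim_linear_image[OF q(1), of A] A(3) q(2) hd by (simp add: d_def of_nat_diff)
    consider "h = 0" | "h = 1" | "h \<ge> 2" by linarith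
    then show ?thesis
    proof cases
      case 1
      then have "{v. q v = 0} \<subseteq> {0}" using q(2) by (simp add: dim_eq_0)
      then have "inj q" using q(1) by (auto simp: linear_injective_0)
      then have "card A = \<kappa>" unfolding \<kappa>_def by (metis card_image inj_on_subset subset_UNIV)
      moreover have "real \<kappa> \<le> (real \<kappa>)\<^sup>2" by (cases \<kappa>) (auto simp: power2_eq_square)
      ultimately have False using big by simp
      then show ?thesis ..
    next
      case 2
      show ?thesis
      proof (cases "\<kappa> \<le> (d + 1)\<^sup>2")
        case True
        then show ?thesis using q 2 unfolding \<kappa>_def by blast
      next
        case False
        \<comment> \<open>The image has affine dimension \<open>d - 1\<close>, so the threshold of
          \<open>many_lines_expand\<close> is \<open>(d + 1)\<^sup>2\<close> and its factor
          \<open>d + 1 + 1/8\<close>.\<close>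
        have d1: "d - h + 2 = d + 1" "real (d - h) = real d - 1" using 2 hd by auto
        obtain S where S: "S \<subseteq> A" "card S \<le> 3 * \<kappa>\<^sup>2"
          "(real (d - h) + 2 + 1/8) * card A - (real \<kappa>)\<^sup>2 \<le> card (A + S)"
          using many_lines_expand[OF A(1) q(1) m] False unfolding \<kappa>_def d1(1) by (metis not_le)
        have "card S \<le> 3 * k'\<^sup>2" using S(2) \<kappa>2 by linarith
        then have "card S \<le> c" by (simp add: c_def)
        from small'[OF S(1) this] S(3) have "(real (d - h) + 2 + 1/8) * card A - (real \<kappa>)\<^sup>2 \<le> K * card A"
          by linarith
        then have "card A \<le> 16 * (real \<kappa>)\<^sup>2" by (simp add: d1(2) K_def algebra_simps)
        then show ?thesis using big by linarith
      qed
    next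
      case 3
      \<comment> \<open>At most \<open>k (d - h)\<close> fibres are below the cut-off, and giving
        them up lowers the factor \<open>2 ^ h\<close> by at most \<open>1/4\<close>.\<close>
      define \<rho> where "\<rho> = 1 / (4 * 2 ^ h * real (k (d - h)))"
      have kpos: "real (k (d - h)) > 0" "real (k (d - (h - 1))) > 0" using k1 by (simp_all add: Suc_le_eq)
      have \<rho>0: "\<rho> > 0" using kpos by (simp add: \<rho>_def)
      have zh: "fst (z h) > 0" by (rule z)
      have "K * (4 * 2 ^ h * k (d - h)) \<le> k (d - (h - 1)) * fst (z h)"
        using kbig[of h] 3 hd zh by (simp add: pos_divide_le_eq)
      then have K\<rho>: "K \<le> k (d - (h - 1)) * (fst (z h) * \<rho>)"
        using kpos by (simp add: \<rho>_def pos_le_divide_eq mult_ac)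
      \<comment> \<open>A smaller kernel does not satisfy \<open>P\<close>, so \<open>A\<close>
        meets many of its translates, and \<open>fibre_bound\<close> shows that none of them is
        rich.\<close>
      have fib: "k (d - (h - 1)) * card {a \<in> A. q' a = y} \<le> K * card A"
        if q': "linear q'" "dim {v. q' v = 0} < h" for q' :: "'a \<Rightarrow> 'a" and y
      proof (rule fibre_bound[OF A(1) q'(1), of c])
        show "card (A + S) \<le> K * card A" if "S \<subseteq> A" "S \<noteq> {}" "card S \<le> c" for S using small that by blast
        show "0 < k (d - (h - 1))" using k1[of "d - (h - 1)"] by linarith
        show "k (d - (h - 1)) \<le> c" using kk'[of "h - 1"] by (simp add: c_def)
        have "\<not> P (dim {v. q' v = 0})" using q'(2) unfolding h_def by (rule not_less_Least)
        then have "k (d - dim {v. q' v = 0}) < card (q' ` A)" using q'(1) unfolding P_def by force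
        moreover have "k (d - (h - 1)) \<le> k (d - dim {v. q' v = 0})" using q'(2) by (intro kmono) auto
        ultimately show "k (d - (h - 1)) \<le> card (q' ` A)" by linarith
      qed
      have expand: "expands (snd (z h)) (2 ^ h - 1/4) {a \<in> A. q a = t}"
        if t: "t \<in> q ` A" "\<rho> * card A \<le> card {a \<in> A. q a = t}" for t
      proof (rule z(2))
        show "nondegenerate h (fst (z h)) {a \<in> A. q a = t}"
          unfolding nondegenerate_def
        proof (intro allI impI)
          fix q' :: "'a \<Rightarrow> 'a" and y assume q': "linear q'" "dim {v. q' v = 0} < h"
          have "card {a \<in> {a \<in> A. q a = t}. q' a = y} \<le> card {a \<in> A. q' a = y}"
            using A(1) by (intro card_mono) auto
          then have "k (d - (h - 1)) * real (card {a \<in> {a \<in> A. q a = t}. q' a = y})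
              \<le> k (d - (h - 1)) * real (card {a \<in> A. q' a = y})" by (intro mult_left_mono) auto
          also have "\<dots> \<le> K * card A" using fib[OF q'] by simp
          also have "\<dots> \<le> k (d - (h - 1)) * (fst (z h) * \<rho>) * card A"
            using K\<rho> by (intro mult_right_mono) auto
          also have "\<dots> = k (d - (h - 1)) * (fst (z h) * (\<rho> * card A))" by simp
          also have "\<dots> \<le> k (d - (h - 1)) * (fst (z h) * card {a \<in> A. q a = t})"
            using t(2) zh by (intro mult_left_mono) auto
          finally show "real (card {a \<in> {a \<in> A. q a = t}. q' a = y}) \<le> fst (z h) * real (card {a \<in> A. q a = t})"
            using kpos(2) by (simp only: mult_le_cancel_left_pos)
        qed
      qed (use A(1) t in auto)
      have "(1::real) \<le> 2 ^ h" by simp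
      then have K': "(0::real) \<le> 2 ^ h - 1/4" by linarith
      obtain S where S: "S \<subseteq> A" "card S \<le> (snd (z h) + 3) * (\<kappa> + \<kappa>\<^sup>2)"
        "((2 ^ h - 1/4) * (1 - \<kappa> * \<rho>) + aff_dim (q ` A)) * card A - (real \<kappa>)\<^sup>2 \<le> card (A + S)"
        unfolding \<kappa>_def
        by (rule expanding_fibres_expand[OF A(1,2) q(1) K' less_imp_le[OF \<rho>0] expand])
      have "snd (z h) \<le> s" unfolding s_def using hd by (intro member_le_sum) auto
      then have "(snd (z h) + 3) * (\<kappa> + \<kappa>\<^sup>2) \<le> (s + 3) * (k' + k'\<^sup>2)"
        by (intro mult_le_mono add_le_mono \<kappa> \<kappa>2) simp_all
      then have "card S \<le> c" using S(2) by (simp add: c_def)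
      from small'[OF S(1) this] S(3)
      have le: "((2 ^ h - 1/4) * (1 - \<kappa> * \<rho>) + real (d - h)) * card A - (real \<kappa>)\<^sup>2 \<le> K * card A"
        unfolding m by simp
      have "real \<kappa> * \<rho> \<le> real (k (d - h)) * \<rho>" using q(3) \<rho>0 by (intro mult_right_mono) (auto simp: \<kappa>_def)
      also have "\<dots> = 1 / (4 * 2 ^ h)" using kpos by (simp add: \<rho>_def)
      finally have "2 ^ h * (real \<kappa> * \<rho>) \<le> 1/4" by (simp add: pos_le_divide_eq mult_ac)
      moreover have "(2 ^ h - 1/4) * (1 - \<kappa> * \<rho>) = 2 ^ h - 1/4 - 2 ^ h * (real \<kappa> * \<rho>) + real \<kappa> * \<rho> / 4"
        by (simp add: field_simps)
      moreover have "0 \<le> real \<kappa> * \<rho> / 4" using \<rho>0 by simp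
      moreover have "real h + 2 \<le> 2 ^ h"
      proof -
        have "h + 2 \<le> 2 ^ h" using 3
        proof (induction h rule: dec_induct)
          case (step n)
          then show ?case by simp
        qed simp
        then have "real (h + 2) \<le> real (2 ^ h)" by (rule of_nat_mono)
        then show ?thesis by simp
      qed
      ultimately have "real h + 3/2 \<le> (2 ^ h - 1/4) * (1 - \<kappa> * \<rho>)" by linarith
      then have "real d + 3/2 \<le> (2 ^ h - 1/4) * (1 - \<kappa> * \<rho>) + real (d - h)"
        using hd by (simp add: of_nat_diff)
      then have "(real d + 3/2) * card A \<le> ((2 ^ h - 1/4) * (1 - \<kappa> * \<rho>) + real (d - h)) * card A"
        by (intro mult_right_mono) auto
      then have "(real d + 3/2) * card A - (real \<kappa>)\<^sup>2 \<le> K * card A" using le by linarith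
      then have "7 * card A \<le> 16 * (real \<kappa>)\<^sup>2" by (simp add: K_def algebra_simps)
      then show ?thesis using big by linarith
    qed
  qed
  have C0: "0 < C" unfolding C_def by (rule add_nonneg_pos) auto
  show ?thesis
    using main C0 by (intro exI[of _ c] exI[of _ C]) (auto simp: c_def d_def K_def)
qed

lemma ex_enumeration:
  assumes "finite S" "S \<noteq> {}" "card S \<le> c"
  shows "\<exists>a :: nat \<Rightarrow> 'a. a ` {1..c} = S"
proof -
  obtain f where f: "bij_betw f {1..card S} S" using ex_bij_betw_nat_finite_1[OF assms(1)] by blast
  have S1: "1 \<in> {1..card S}" using assms by (simp add: Suc_le_eq card_gt_0_iff)
  \<comment> \<open>The hypothesis of the theorem speaks of exactly \<open>c\<close> entries, so a
    smaller set is listed with its first element repeated.\<close>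
  define a where "a i = (if i \<le> card S then f i else f 1)" for i
  have "a ` {1..c} = S"
  proof
    show "a ` {1..c} \<subseteq> S"
    proof
      fix v assume "v \<in> a ` {1..c}"
      then obtain i where "i \<ge> 1" "v = a i" by auto
      then show "v \<in> S" using bij_betwE[OF f] S1 by (auto simp: a_def)
    qed
    show "S \<subseteq> a ` {1..c}"
    proof
      fix v assume "v \<in> S"
      then have "v \<in> f ` {1..card S}" using f by (simp only: bij_betw_def)
      then obtain i where "i \<in> {1..card S}" "v = f i" by blast
      then show "v \<in> a ` {1..c}" using assms(3) by (intro image_eqI[of _ _ i]) (auto simp: a_def)
    qed
  qed
  then show ?thesis by blast
qed

theorem theorem1p5:
  "\<exists>(c::nat) (C::real). 1 \<le> c \<and> 0 < C \<and>
     (\<forall>A :: (real ^ 'n::finite) set.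
        finite A \<and> A \<noteq> {} \<and> aff_dim A = int CARD('n) \<and>
        (\<forall>a :: nat \<Rightarrow> real ^ 'n.
           (\<forall>i\<in>{1..c}. a i \<in> A) \<longrightarrow>
           real (card (A + a ` {1..c})) \<le> (real CARD('n) + 1 + 1/16) * real (card A))
        \<longrightarrow>
        real (card A) \<le> C \<or>
        (\<exists>(l :: (real ^ 'n) set) (T :: (real ^ 'n) set).
           subspace l \<and> dim l = 1 \<and>
           finite T \<and> card T \<le> (CARD('n) + 1)^2 \<and>
           A \<subseteq> T + l))"
proof -
  obtain c and C :: real where cC: "1 \<le> c" "0 < C" "\<And>A :: (real ^ 'n) set. finite A \<Longrightarrow> A \<noteq> {} \<Longrightarrow>
     aff_dim A = int CARD('n) \<Longrightarrow>
     (\<And>S. S \<subseteq> A \<Longrightarrow> S \<noteq> {} \<Longrightarrow> card S \<le> c \<Longrightarrow> card (A + S) \<le> (real CARD('n) + 1 + 1/16) * card A) \<Longrightarrow>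
     card A \<le> C \<or>
     (\<exists>q :: real ^ 'n \<Rightarrow> real ^ 'n. linear q \<and> dim {v. q v = 0} = 1 \<and> card (q ` A) \<le> (CARD('n) + 1)\<^sup>2)"
    using few_lines_or_expand[where 'a="real ^ 'n"] by (simp add: DIM_cart) blast
  show ?thesis
  proof (intro exI[of _ c] exI[of _ C] conjI allI impI)
    fix A :: "(real ^ 'n) set"
    assume A: "finite A \<and> A \<noteq> {} \<and> aff_dim A = int CARD('n) \<and>
        (\<forall>a :: nat \<Rightarrow> real ^ 'n. (\<forall>i\<in>{1..c}. a i \<in> A) \<longrightarrow>
           real (card (A + a ` {1..c})) \<le> (real CARD('n) + 1 + 1/16) * real (card A))"
    have small: "card (A + S) \<le> (real CARD('n) + 1 + 1/16) * card A"
      if S: "S \<subseteq> A" "S \<noteq> {}" "card S \<le> c" for S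
    proof -
      have "finite S" using S(1) A finite_subset by blast
      then obtain a :: "nat \<Rightarrow> real ^ 'n" where a: "a ` {1..c} = S" using ex_enumeration[OF _ S(2,3)] by blast
      then have "\<forall>i\<in>{1..c}. a i \<in> A" using S(1) by blast
      then show ?thesis using A a by blast
    qed
    show "real (card A) \<le> C \<or>
        (\<exists>(l :: (real ^ 'n) set) (T :: (real ^ 'n) set).
           subspace l \<and> dim l = 1 \<and> finite T \<and> card T \<le> (CARD('n) + 1)^2 \<and> A \<subseteq> T + l)"
    proof (cases "card A \<le> C")
      case False
      then obtain q :: "real ^ 'n \<Rightarrow> real ^ 'n" where
        q: "linear q" "dim {v. q v = 0} = 1" "card (q ` A) \<le> (CARD('n) + 1)\<^sup>2"
        using cC(3)[of A] A small by blast
      \<comment> \<open>One representative of each fibre: \<open>T\<close> lists the translates of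
        the kernel, which is the line \<open>l\<close>.\<close>
      obtain T where T: "T \<subseteq> A" "inj_on q T" "q ` A = q ` T" by (metis subset_image_inj order_refl)
      have "A \<subseteq> T + {v. q v = 0}"
      proof
        fix a assume "a \<in> A"
        then obtain t where t: "t \<in> T" "q a = q t" using T(3) by (metis image_iff)
        then have "a - t \<in> {v. q v = 0}" using q(1) by (simp add: linear_diff)
        with t(1) have "t + (a - t) \<in> T + {v. q v = 0}" by (rule set_plus_intro)
        then show "a \<in> T + {v. q v = 0}" by simp
      qed
      moreover have "finite T" using T(1) A finite_subset by blast
      moreover have "card T \<le> (CARD('n) + 1)\<^sup>2" using q(3) T by (simp add: card_image)
      ultimately show ?thesis using q(2) linear_subspace_kernel[OF q(1)] by blast
    qed simp
  qed (use cC in auto)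
qed

end
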